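(* For each cost function $c$ satisfying the limit condition, there is a $1$-random $\Delta^0_2$ set $Y$ such that every c.e. set $A\le_{\mathrm T}Y$ obeys $c$.
   Context: Sets are subsets of $\omega$, identified with elements of $2^\omega$; $\lambda$ is the uniform (fair coin) measure on $2^\omega$; $\le_{\mathrm T}$ is Turing reducibility. A Martin-Löf test is a uniformly c.e. sequence $(\mathcal G_n)_{n\in\omega}$ of effectively open subsets of $2^\omega$ with $\lambda\mathcal G_n\le 2^{-n}$ for all $n$. A set $Z$ is $1$-random if for every Martin-Löf test, $Z\notin\mathcal G_n$ for almost all $n$. A cost function is a computable function $c(x,s)$ ($x,s\in\omega$) taking non-negative rational values. It satisfies the limit condition if $\lim_s c(x,s)$ is finite for all $x$ and $\lim_{x\to\infty}\sup_s c(x,s)=0$. A computable approximation to a $\Delta^0_2$ set $A$ is a uniformly computable sequence $(A_s)_{s\in\omega}$ such that for each $n$, $A_s(n)=A(n)$ for almost all $s$. The total cost of $(A_s)$ according to $c$ is the sum, over all stages $s>0$ for which there is some $x<s$ with $A_{s-1}(x)\ne A_s(x)$, of $c(x_s,s)$, where $x_s$ is the least such $x$. The approximation $(A_s)$ obeys $c$ if this total cost is finite. A $\Delta^0_2$ set obeys $c$ if it has some computable approximation that obeys $c$. *)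

theory Defs
  imports "HOL-Probability.Probability" "HOL-Library.Nat_Bijection"
begin

section \<open>Partial recursive functions with a set oracle\<close>

datatype recf =
    Zero
  | Succ
  | Proj nat
  | Oracle
  | Comp recf "recf list"
  | Prec recf recf
  | Mn recf

text \<open>
  \<open>eval X p xs y\<close>: the program \<open>p\<close> with oracle \<open>X\<close> halts on the arguments \<open>xs\<close> with value \<open>y\<close>.
  The recursion variable of \<open>Prec\<close> and the search variable of \<open>Mn\<close> are the first argument;
  \<open>Mn\<close> requires convergence at all values below the one found. If no rule applies, for
  instance because the number of arguments is wrong, the computation diverges.
\<close>

inductive eval :: "nat set \<Rightarrow> recf \<Rightarrow> nat list \<Rightarrow> nat \<Rightarrow> bool" for X :: "nat set" where
  eval_Zero: "eval X Zero xs 0"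
| eval_Succ: "eval X Succ [x] (Suc x)"
| eval_Proj: "i < length xs \<Longrightarrow> eval X (Proj i) xs (xs ! i)"
| eval_Oracle: "eval X Oracle [x] (of_bool (x \<in> X))"
| eval_Comp: "list_all2 (\<lambda>g y. eval X g xs y) gs ys \<Longrightarrow> eval X f ys z \<Longrightarrow> eval X (Comp f gs) xs z"
| eval_Prec_0: "eval X f xs y \<Longrightarrow> eval X (Prec f g) (0 # xs) y"
| eval_Prec_Suc: "eval X (Prec f g) (n # xs) r \<Longrightarrow> eval X g (n # r # xs) y \<Longrightarrow>
    eval X (Prec f g) (Suc n # xs) y"
| eval_Mn: "eval X f (n # xs) 0 \<Longrightarrow> (\<And>m. m < n \<Longrightarrow> \<exists>k. eval X f (m # xs) (Suc k)) \<Longrightarrow>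
    eval X (Mn f) xs n"

lemma eval_deterministic: "eval X p xs y \<Longrightarrow> eval X p xs z \<Longrightarrow> y = z"
proof (induction arbitrary: z rule: eval.induct)
  case (eval_Comp xs gs ys f w)
  from eval_Comp.prems obtain ys' where ys': "list_all2 (\<lambda>g y. eval X g xs y) gs ys'" "eval X f ys' z"
    by cases auto
  have "ys = ys'"
    using eval_Comp.IH(1) ys'(1)
    by (auto simp: list_all2_conv_all_nth intro!: nth_equalityI)
  with ys'(2) eval_Comp.IH(2) show ?case by blast
next
  case (eval_Mn f n xs)
  from eval_Mn.prems have z: "eval X f (z # xs) 0" "\<And>m. m < z \<Longrightarrow> \<exists>k. eval X f (m # xs) (Suc k)"
    by (cases; blast)+
  show ?case
  proof (rule linorder_cases[of n z])
    assume "n < z"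
    then show ?thesis using z(2) eval_Mn.IH(1) by blast
  next
    assume "z < n"
    then obtain k where "\<forall>w. eval X f (z # xs) w \<longrightarrow> Suc k = w" using eval_Mn.IH(2) by blast
    then show ?thesis using z(1) by blast
  qed
next
  case (eval_Prec_Suc f g n xs r y)
  from eval_Prec_Suc.prems obtain r' where "eval X (Prec f g) (n # xs) r'" "eval X g (n # r' # xs) z"
    by cases auto
  with eval_Prec_Suc.IH show ?case by blast
qed (erule eval.cases; fastforce)+

text \<open>Unrelativized computability is computability with the empty oracle.\<close>

definition computable2 :: "(nat \<Rightarrow> nat \<Rightarrow> nat) \<Rightarrow> bool" where
  "computable2 f \<longleftrightarrow> (\<exists>p. \<forall>x y. eval {} p [x, y] (f x y))"

definition computable_rel3 :: "(nat \<Rightarrow> nat \<Rightarrow> nat \<Rightarrow> bool) \<Rightarrow> bool" where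
  "computable_rel3 R \<longleftrightarrow> (\<exists>p. \<forall>x y z. eval {} p [x, y, z] (of_bool (R x y z)))"

definition ce_set :: "nat set \<Rightarrow> bool" where
  "ce_set A \<longleftrightarrow> (\<exists>p. \<forall>x. x \<in> A \<longleftrightarrow> (\<exists>y. eval {} p [x] y))"

definition turing_reducible :: "nat set \<Rightarrow> nat set \<Rightarrow> bool" (infix \<open>\<le>\<^sub>T\<close> 50) where
  "A \<le>\<^sub>T Y \<longleftrightarrow> (\<exists>p. \<forall>x. eval Y p [x] (of_bool (x \<in> A)))"

definition sigma02 :: "nat set \<Rightarrow> bool" where
  "sigma02 A \<longleftrightarrow> (\<exists>R. computable_rel3 R \<and> (\<forall>x. x \<in> A \<longleftrightarrow> (\<exists>y. \<forall>z. R x y z)))"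

definition pi02 :: "nat set \<Rightarrow> bool" where
  "pi02 A \<longleftrightarrow> (\<exists>R. computable_rel3 R \<and> (\<forall>x. x \<in> A \<longleftrightarrow> (\<forall>y. \<exists>z. R x y z)))"

definition delta02 :: "nat set \<Rightarrow> bool" where
  "delta02 A \<longleftrightarrow> sigma02 A \<and> pi02 A"


section \<open>Martin-Loef randomness\<close>

text \<open>Points of Cantor space are characteristic functions; a set \<open>Z\<close> is the point \<open>\<lambda>i. i \<in> Z\<close>.\<close>

definition coin_measure :: "(nat \<Rightarrow> bool) measure" where
  "coin_measure = PiM UNIV (\<lambda>_. measure_pmf (bernoulli_pmf (1/2)))"

definition cylinder :: "bool list \<Rightarrow> (nat \<Rightarrow> bool) set" where
  "cylinder \<sigma> = {f. \<forall>i < length \<sigma>. f i = \<sigma> ! i}"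

definition string_code :: "bool list \<Rightarrow> nat" where
  "string_code \<sigma> = list_encode (map of_bool \<sigma>)"

definition uniformly_ce_open :: "(nat \<Rightarrow> (nat \<Rightarrow> bool) set) \<Rightarrow> bool" where
  "uniformly_ce_open G \<longleftrightarrow>
    (\<exists>p. \<forall>n. G n = (\<Union>\<sigma> \<in> {\<sigma>. \<exists>y. eval {} p [n, string_code \<sigma>] y}. cylinder \<sigma>))"

definition martin_loef_test :: "(nat \<Rightarrow> (nat \<Rightarrow> bool) set) \<Rightarrow> bool" where
  "martin_loef_test G \<longleftrightarrow> uniformly_ce_open G \<and> (\<forall>n. measure coin_measure (G n) \<le> (1/2) ^ n)"

definition one_random :: "nat set \<Rightarrow> bool" where
  "one_random Z \<longleftrightarrow>
    (\<forall>G. martin_loef_test G \<longrightarrow> (\<forall>\<^sub>F n in sequentially. (\<lambda>i. i \<in> Z) \<notin> G n))"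


section \<open>Cost functions\<close>

text \<open>A function into the rationals is computable if numerators and denominators can be computed.\<close>

definition cost_function :: "(nat \<Rightarrow> nat \<Rightarrow> rat) \<Rightarrow> bool" where
  "cost_function c \<longleftrightarrow> (\<exists>a b. computable2 a \<and> computable2 b \<and>
    (\<forall>x s. b x s > 0 \<and> c x s = of_nat (a x s) / of_nat (b x s)))"

text \<open>The first conjunct makes the supremum in the second one that of a bounded set.\<close>

definition limit_condition :: "(nat \<Rightarrow> nat \<Rightarrow> rat) \<Rightarrow> bool" where
  "limit_condition c \<longleftrightarrow>
    (\<forall>x. convergent (\<lambda>s. real_of_rat (c x s))) \<and>
    (\<lambda>x. SUP s. real_of_rat (c x s)) \<longlonglongrightarrow> 0"

definition computable_approximation :: "(nat \<Rightarrow> nat set) \<Rightarrow> nat set \<Rightarrow> bool" where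
  "computable_approximation As A \<longleftrightarrow>
    computable2 (\<lambda>s n. of_bool (n \<in> As s)) \<and>
    (\<forall>n. \<forall>\<^sub>F s in sequentially. n \<in> As s \<longleftrightarrow> n \<in> A)"

definition changes_at :: "(nat \<Rightarrow> nat set) \<Rightarrow> nat \<Rightarrow> nat \<Rightarrow> bool" where
  "changes_at As s x \<longleftrightarrow> x < s \<and> (x \<in> As (s - 1)) \<noteq> (x \<in> As s)"

definition total_cost :: "(nat \<Rightarrow> nat \<Rightarrow> rat) \<Rightarrow> (nat \<Rightarrow> nat set) \<Rightarrow> ennreal" where
  "total_cost c As =
    (\<Sum>s. if s > 0 \<and> (\<exists>x. changes_at As s x)
         then ennreal (real_of_rat (c (LEAST x. changes_at As s x) s)) else 0)"

definition obeys :: "nat set \<Rightarrow> (nat \<Rightarrow> nat \<Rightarrow> rat) \<Rightarrow> bool" where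
  "obeys A c \<longleftrightarrow> (\<exists>As. computable_approximation As A \<and> total_cost c As < \<infinity>)"

end

theory Submission
  imports Defs
begin

text \<open>
  Let \<open>A\<close> be c.e. and computed from \<open>Y\<close> by a functional, and consider for each \<open>n\<close> the open set of
  oracles that compute \<open>A\<close> correctly on the finitely many numbers whose cost is at some stage above
  a threshold \<open>\<delta> n\<close>. If its measure exceeds \<open>\<epsilon> n\<close> for every \<open>n\<close>, then \<open>A\<close> obeys \<open>c\<close>: enumerate
  \<open>A\<close> only at stages where these sets already look large. A later enumeration of a number with cost
  above \<open>\<delta> n\<close> refutes a set of oracles of measure above \<open>\<epsilon> n\<close>, and the sets refuted at level \<open>n\<close> are
  disjoint, so this happens at most \<open>1 / \<epsilon> n\<close> times. The total cost is finite if \<open>\<delta> n\<close> is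
  small compared to \<open>\<epsilon> (n + 1)\<close>.

  It therefore suffices that \<open>Y\<close> avoids each such set whose measure is at most \<open>\<epsilon> n\<close>, together with
  the tails of all Martin-Loef tests. These open sets have approximations that are eventually
  increasing, and their measures sum to less than 1. So \<open>Y\<close> can be built bit by bit, keeping
  the conditional measure of the sets considered so far below 1; every decision is the limit of
  a computable sequence, which makes \<open>Y\<close> a \<open>\<Delta>\<^sup>0\<^sub>2\<close> set.
\<close>

section \<open>Computable functions\<close>

definition nfst :: "nat \<Rightarrow> nat" where "nfst z = fst (prod_decode z)"
definition nsnd :: "nat \<Rightarrow> nat" where "nsnd z = snd (prod_decode z)"
definition npair :: "nat \<Rightarrow> nat \<Rightarrow> nat" where "npair x y = prod_encode (x, y)"

lemma nfst_npair [simp]: "nfst (npair x y) = x"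
  and nsnd_npair [simp]: "nsnd (npair x y) = y"
  and npair_nfst_nsnd [simp]: "npair (nfst z) (nsnd z) = z"
  by (simp_all add: nfst_def nsnd_def npair_def)

definition computable1 :: "(nat \<Rightarrow> nat) \<Rightarrow> bool" where
  "computable1 f \<longleftrightarrow> (\<exists>p. \<forall>x. eval {} p [x] (f x))"

definition decidable1 :: "(nat \<Rightarrow> bool) \<Rightarrow> bool" where
  "decidable1 P \<longleftrightarrow> computable1 (\<lambda>x. of_bool (P x))"

lemma eval_Comp1: "eval X g xs y \<Longrightarrow> eval X f [y] z \<Longrightarrow> eval X (Comp f [g]) xs z"
  by (rule eval_Comp[where ys = "[y]"]) auto

lemma eval_Comp2:
  "eval X g xs y \<Longrightarrow> eval X h xs y' \<Longrightarrow> eval X f [y, y'] z \<Longrightarrow> eval X (Comp f [g, h]) xs z"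
  by (rule eval_Comp[where ys = "[y, y']"]) auto

lemma eval_Proj_simps:
  "eval X (Proj 0) (x # xs) x"
  "eval X (Proj 1) (x # y # xs) y"
  "eval X (Proj 2) (x # y # z # xs) z"
  using eval_Proj[of 0 "x # xs" X] eval_Proj[of 1 "x # y # xs" X] eval_Proj[of 2 "x # y # z # xs" X]
  by auto

lemma eval_Prec_rec_nat:
  assumes "eval X f xs a" and "\<And>n r. eval X g (n # r # xs) (h n r)"
  shows "eval X (Prec f g) (n # xs) (rec_nat a h n)"
  using assms by (induction n) (auto intro: eval_Prec_0 eval_Prec_Suc)

lemma computable1_id: "computable1 (\<lambda>x. x)"
  unfolding computable1_def using eval_Proj_simps(1) by blast

lemma computable1_const: "computable1 (\<lambda>_. k)"
proof (induction k)
  case 0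
  show ?case unfolding computable1_def using eval_Zero by blast
next
  case (Suc k)
  then obtain p where "\<forall>x. eval {} p [x] k" unfolding computable1_def by blast
  then have "\<forall>x. eval {} (Comp Succ [p]) [x] (Suc k)" by (blast intro: eval_Comp1 eval_Succ)
  then show ?case unfolding computable1_def by blast
qed

lemma computable1_comp:
  assumes "computable1 f" "computable1 g"
  shows "computable1 (\<lambda>x. f (g x))"
proof -
  obtain p q where "\<forall>x. eval {} p [x] (f x)" "\<forall>x. eval {} q [x] (g x)"
    using assms unfolding computable1_def by blast
  then have "\<forall>x. eval {} (Comp p [q]) [x] (f (g x))" by (blast intro: eval_Comp1)
  then show ?thesis unfolding computable1_def by blast
qed

lemma computable1_Suc: "computable1 f \<Longrightarrow> computable1 (\<lambda>x. Suc (f x))"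
  by (rule computable1_comp) (auto simp: computable1_def intro: eval_Succ)

lemma computable2_comp:
  assumes "computable2 F" "computable1 f" "computable1 g"
  shows "computable1 (\<lambda>x. F (f x) (g x))"
proof -
  obtain P p q where "\<forall>x y. eval {} P [x, y] (F x y)" "\<forall>x. eval {} p [x] (f x)" "\<forall>x. eval {} q [x] (g x)"
    using assms unfolding computable1_def computable2_def by blast
  then have "\<forall>x. eval {} (Comp P [p, q]) [x] (F (f x) (g x))" by (blast intro: eval_Comp2)
  then show ?thesis unfolding computable1_def by blast
qed

lemma computable2_add: "computable2 (+)"
proof -
  have "eval {} (Prec (Proj 0) (Comp Succ [Proj 1])) [x, y] (rec_nat y (\<lambda>_. Suc) x)" for x y
    by (rule eval_Prec_rec_nat eval_Comp1 eval_Proj_simps eval_Succ)+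
  moreover have "rec_nat y (\<lambda>_. Suc) x = x + y" for x y by (induction x) auto
  ultimately show ?thesis unfolding computable2_def by metis
qed

lemma computable1_pred: "computable1 (\<lambda>x. x - 1)"
proof -
  have "eval {} (Prec Zero (Proj 0)) [x] (rec_nat 0 (\<lambda>n _. n) x)" for x
    by (rule eval_Prec_rec_nat eval_Proj_simps eval_Zero)+
  moreover have "rec_nat 0 (\<lambda>n _. n) x = x - 1" for x by (cases x) auto
  ultimately show ?thesis unfolding computable1_def by metis
qed

lemma computable2_diff: "computable2 (\<lambda>x y. y - x)"
proof -
  obtain p where p: "\<And>x. eval {} p [x] (x - 1)" using computable1_pred unfolding computable1_def by blast
  have "eval {} (Prec (Proj 0) (Comp p [Proj 1])) [x, y] (rec_nat y (\<lambda>_ r. r - 1) x)" for x y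
    by (rule eval_Prec_rec_nat eval_Comp1 eval_Proj_simps p)+
  moreover have "rec_nat y (\<lambda>_ r. r - 1) x = y - x" for x y by (induction x) auto
  ultimately show ?thesis unfolding computable2_def by metis
qed

lemma computable2_mult: "computable2 (*)"
proof -
  obtain p where p: "\<And>x y. eval {} p [x, y] (x + y)" using computable2_add unfolding computable2_def by blast
  have "eval {} (Prec Zero (Comp p [Proj 1, Proj 2])) [x, y] (rec_nat 0 (\<lambda>_ r. r + y) x)" for x y
    by (rule eval_Prec_rec_nat eval_Comp2 eval_Proj_simps p eval_Zero)+
  moreover have "rec_nat 0 (\<lambda>_ r. r + y) x = x * y" for x y by (induction x) auto
  ultimately show ?thesis unfolding computable2_def by metis
qed

lemma computable1_triangle: "computable1 triangle"
proof -
  obtain p where p: "\<And>x y. eval {} p [x, y] (x + y)" using computable2_add unfolding computable2_def by blast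
  have "eval {} (Prec Zero (Comp p [Comp Succ [Proj 0], Proj 1])) [x] (rec_nat 0 (\<lambda>n r. Suc n + r) x)" for x
    by (rule eval_Prec_rec_nat eval_Comp1 eval_Comp2 eval_Proj_simps p eval_Zero eval_Succ)+
  moreover have "rec_nat 0 (\<lambda>n r. Suc n + r) x = triangle x" for x by (induction x) auto
  ultimately show ?thesis unfolding computable1_def by metis
qed

lemmas computable1_add = computable2_comp[OF computable2_add]
  and computable1_diff = computable2_comp[OF computable2_diff]
  and computable1_mult = computable2_comp[OF computable2_mult]

lemma computable2_npair: "computable2 npair"
proof -
  obtain p q where p: "\<And>x y. eval {} p [x, y] (x + y)" and q: "\<And>x. eval {} q [x] (triangle x)"
    using computable2_add computable1_triangle unfolding computable1_def computable2_def by metis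
  have "eval {} (Comp p [Comp q [p], Proj 0]) [x, y] (triangle (x + y) + x)" for x y
    by (rule eval_Comp1 eval_Comp2 eval_Proj_simps p q)+
  then show ?thesis unfolding computable2_def npair_def prod_encode_def by auto
qed

lemmas computable1_npair = computable2_comp[OF computable2_npair]

lemma computable1_Mn:
  assumes "computable2 f" and "\<And>x. \<exists>y. f y x = 0"
  shows "computable1 (\<lambda>x. LEAST y. f y x = 0)"
proof -
  obtain p where p: "\<And>x y. eval {} p [y, x] (f y x)"
    using assms(1) unfolding computable2_def by blast
  have "eval {} (Mn p) [x] (LEAST y. f y x = 0)" for x
  proof (rule eval_Mn)
    show "eval {} p [LEAST y. f y x = 0, x] 0"
      using p[of "LEAST y. f y x = 0" x] LeastI_ex[OF assms(2)] by metis
    fix m assume "m < (LEAST y. f y x = 0)"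
    then have "f m x \<noteq> 0" by (rule not_less_Least)
    then show "\<exists>k. eval {} p [m, x] (Suc k)" using p[of m x] by (metis not0_implies_Suc)
  qed
  then show ?thesis unfolding computable1_def by blast
qed

section \<open>Inverting the Cantor pairing function\<close>

lemma mono_triangle: "m \<le> n \<Longrightarrow> triangle m \<le> triangle n"
  by (rule lift_Suc_mono_le[of triangle]) auto

text \<open>The sum of the two components of the pair coded by \<open>z\<close>: the codes of pairs
  with sum \<open>w\<close> fill the interval from \<open>triangle w\<close> to below
  \<open>triangle (Suc w)\<close>, so an unbounded search finds it.\<close>

definition triroot :: "nat \<Rightarrow> nat" where
  "triroot z = (LEAST w. z < triangle (Suc w))"

lemma triroot_npair: "triroot (npair m n) = m + n"
  unfolding triroot_def
proof (rule Least_equality)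
  fix w assume *: "npair m n < triangle (Suc w)"
  show "m + n \<le> w"
  proof (rule ccontr)
    assume "\<not> m + n \<le> w"
    then have "triangle (Suc w) \<le> triangle (m + n)" by (intro mono_triangle) simp
    then show False using * by (simp add: npair_def prod_encode_def)
  qed
qed (simp add: npair_def prod_encode_def)

lemma computable1_triroot: "computable1 triroot"
proof -
  obtain p q where p: "\<And>x y. eval {} p [x, y] (y - x)" and q: "\<And>x. eval {} q [x] (triangle x)"
    using computable2_diff computable1_triangle unfolding computable1_def computable2_def by blast
  have "eval {} (Comp p [Comp q [Comp Succ [Proj 0]], Comp Succ [Proj 1]]) [w, z] (Suc z - triangle (Suc w))" for w z
    by (rule eval_Comp1 eval_Comp2 eval_Proj_simps p q eval_Succ)+
  then have "computable2 (\<lambda>w z. Suc z - triangle (Suc w))"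
    unfolding computable2_def by blast
  moreover have "\<exists>w. Suc z - triangle (Suc w) = 0" for z
    by (rule exI[of _ z]) simp
  ultimately have "computable1 (\<lambda>z. LEAST w. Suc z - triangle (Suc w) = 0)"
    by (rule computable1_Mn)
  then show ?thesis
    by (simp add: triroot_def[abs_def] less_Suc_eq_le)
qed

lemma computable1_nfst_id: "computable1 nfst"
proof -
  have "nfst z = z - triangle (triroot z)" for z
    using triroot_npair[of "nfst z" "nsnd z"] npair_nfst_nsnd[of z]
    unfolding npair_def prod_encode_def by simp
  moreover have "computable1 (\<lambda>z. z - triangle (triroot z))"
    by (intro computable1_diff computable1_comp[OF computable1_triangle] computable1_id computable1_triroot)
  ultimately show ?thesis by presburger
qed

lemma computable1_nsnd_id: "computable1 nsnd"
proof -
  have "nsnd z = triroot z - nfst z" for z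
    using triroot_npair[of "nfst z" "nsnd z"] by simp
  moreover have "computable1 (\<lambda>z. triroot z - nfst z)"
    by (intro computable1_diff computable1_nfst_id computable1_triroot)
  ultimately show ?thesis by presburger
qed

lemmas computable1_nfst = computable1_comp[OF computable1_nfst_id]
  and computable1_nsnd = computable1_comp[OF computable1_nsnd_id]

text \<open>Computability is treated throughout for unary functions of a context, with further
  arguments packed by \<open>npair\<close>. This rule and the composition rules below unpack them
  again.\<close>

lemma computable2I:
  assumes "computable1 (\<lambda>z. F (nfst z) (nsnd z))"
  shows "computable2 F"
proof -
  obtain p q where p: "\<And>z. eval {} p [z] (F (nfst z) (nsnd z))" and q: "\<And>x y. eval {} q [x, y] (npair x y)"
    using assms computable2_npair unfolding computable1_def computable2_def by blast
  have "eval {} (Comp p [q]) [x, y] (F x y)" for x y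
    using eval_Comp1[OF q p, of x y] by simp
  then show ?thesis unfolding computable2_def by blast
qed

lemmas computable_compose2 = computable2_comp[OF computable2I]

lemma computable_compose3:
  assumes "computable1 (\<lambda>z. F (nfst z) (nfst (nsnd z)) (nsnd (nsnd z)))"
    and "computable1 f" "computable1 g" "computable1 h"
  shows "computable1 (\<lambda>x. F (f x) (g x) (h x))"
  using computable1_comp[OF assms(1) computable1_npair[OF assms(2) computable1_npair[OF assms(3,4)]]] by simp

lemma computable_compose4:
  assumes "computable1 (\<lambda>z. F (nfst z) (nfst (nsnd z)) (nfst (nsnd (nsnd z))) (nsnd (nsnd (nsnd z))))"
    and "computable1 f" "computable1 g" "computable1 h" "computable1 k"
  shows "computable1 (\<lambda>x. F (f x) (g x) (h x) (k x))"
  using computable1_comp[OF assms(1) computable1_npair[OF assms(2)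
      computable1_npair[OF assms(3) computable1_npair[OF assms(4,5)]]]] by simp

lemma computable_compose5:
  assumes "computable1 (\<lambda>z. F (nfst z) (nfst (nsnd z)) (nfst (nsnd (nsnd z)))
      (nfst (nsnd (nsnd (nsnd z)))) (nsnd (nsnd (nsnd (nsnd z)))))"
    and "computable1 f" "computable1 g" "computable1 h" "computable1 k" "computable1 l"
  shows "computable1 (\<lambda>x. F (f x) (g x) (h x) (k x) (l x))"
  using computable1_comp[OF assms(1) computable1_npair[OF assms(2) computable1_npair[OF assms(3)
      computable1_npair[OF assms(4) computable1_npair[OF assms(5,6)]]]]] by simp

lemma computable_rel3I:
  assumes "decidable1 (\<lambda>z. R (nfst z) (nfst (nsnd z)) (nsnd (nsnd z)))"
  shows "computable_rel3 R"
proof -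
  obtain p q where p: "\<And>z. eval {} p [z] (of_bool (R (nfst z) (nfst (nsnd z)) (nsnd (nsnd z))))"
    and q: "\<And>x y. eval {} q [x, y] (npair x y)"
    using assms computable2_npair unfolding decidable1_def computable1_def computable2_def by blast
  have "eval {} (Comp p [Comp q [Proj 0, Comp q [Proj 1, Proj 2]]]) [x, y, z]
      (of_bool (R (nfst (npair x (npair y z))) (nfst (nsnd (npair x (npair y z)))) (nsnd (nsnd (npair x (npair y z))))))" for x y z
    by (rule eval_Comp1 eval_Comp2 eval_Proj_simps p q)+
  then have "eval {} (Comp p [Comp q [Proj 0, Comp q [Proj 1, Proj 2]]]) [x, y, z] (of_bool (R x y z))" for x y z
    by (simp only: nfst_npair nsnd_npair)
  then show ?thesis unfolding computable_rel3_def by blast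
qed

lemma computable1_rec_nat:
  assumes "computable1 f" "computable1 b"
    and "computable1 (\<lambda>z. h (nfst z) (nfst (nsnd z)) (nsnd (nsnd z)))"
  shows "computable1 (\<lambda>x. rec_nat (f x) (\<lambda>n r. h n r x) (b x))"
proof -
  obtain p q r where p: "\<And>x. eval {} p [x] (f x)"
    and q: "\<And>z. eval {} q [z] (h (nfst z) (nfst (nsnd z)) (nsnd (nsnd z)))"
    and r: "\<And>x y. eval {} r [x, y] (npair x y)"
    using assms computable2_npair unfolding computable1_def computable2_def by blast
  have step: "eval {} (Comp q [Comp r [Proj 0, Comp r [Proj 1, Proj 2]]]) [n, y, x] (h n y x)" for n y x
  proof -
    have "eval {} (Comp q [Comp r [Proj 0, Comp r [Proj 1, Proj 2]]]) [n, y, x]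
      (h (nfst (npair n (npair y x))) (nfst (nsnd (npair n (npair y x)))) (nsnd (nsnd (npair n (npair y x)))))"
      by (rule eval_Comp1 eval_Comp2 eval_Proj_simps q r)+
    then show ?thesis by simp
  qed
  have "eval {} (Prec p (Comp q [Comp r [Proj 0, Comp r [Proj 1, Proj 2]]])) [n, x] (rec_nat (f x) (\<lambda>n r. h n r x) n)" for n x
    by (rule eval_Prec_rec_nat p step)+
  then have "computable2 (\<lambda>n x. rec_nat (f x) (\<lambda>n r. h n r x) n)"
    unfolding computable2_def by blast
  from computable2_comp[OF this assms(2) computable1_id] show ?thesis .
qed

section \<open>Decidable predicates and bounded arithmetic\<close>

lemma computable1_of_bool: "decidable1 P \<Longrightarrow> computable1 (\<lambda>x. of_bool (P x))"
  by (simp add: decidable1_def)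

lemma decidable1_eq_0: "computable1 f \<Longrightarrow> decidable1 (\<lambda>x. f x = 0)"
proof -
  assume "computable1 f"
  then have "computable1 (\<lambda>x. 1 - f x)" by (intro computable1_diff computable1_const)
  moreover have "1 - f x = of_bool (f x = 0)" for x by auto
  ultimately show ?thesis by (simp add: decidable1_def)
qed

lemma decidable1_not: "decidable1 P \<Longrightarrow> decidable1 (\<lambda>x. \<not> P x)"
  using decidable1_eq_0[of "\<lambda>x. of_bool (P x)"] by (simp add: decidable1_def)

lemma decidable1_conj:
  assumes "decidable1 P" "decidable1 Q" shows "decidable1 (\<lambda>x. P x \<and> Q x)"
proof -
  have "computable1 (\<lambda>x. of_bool (P x) * of_bool (Q x))"
    using assms by (intro computable1_mult computable1_of_bool)
  then show ?thesis by (simp add: decidable1_def of_bool_conj)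
qed

lemma decidable1_disj: "decidable1 P \<Longrightarrow> decidable1 Q \<Longrightarrow> decidable1 (\<lambda>x. P x \<or> Q x)"
  using decidable1_not[OF decidable1_conj[OF decidable1_not decidable1_not, of P Q]] by simp

lemma decidable1_imp: "decidable1 P \<Longrightarrow> decidable1 Q \<Longrightarrow> decidable1 (\<lambda>x. P x \<longrightarrow> Q x)"
  unfolding imp_conv_disj by (intro decidable1_disj decidable1_not)

lemma decidable1_le: "computable1 f \<Longrightarrow> computable1 g \<Longrightarrow> decidable1 (\<lambda>x. f x \<le> g x)"
  using decidable1_eq_0[OF computable1_diff[of g f]] by simp

lemma decidable1_less: "computable1 f \<Longrightarrow> computable1 g \<Longrightarrow> decidable1 (\<lambda>x. f x < g x)"
  using decidable1_le[OF computable1_Suc, of f g] by (simp add: Suc_le_eq)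

lemma decidable1_eq: "computable1 f \<Longrightarrow> computable1 g \<Longrightarrow> decidable1 (\<lambda>x. f x = g x)"
  using decidable1_conj[OF decidable1_le decidable1_le, of f g g f] by (simp add: eq_iff)

lemma computable1_If:
  assumes "decidable1 P" "computable1 f" "computable1 g"
  shows "computable1 (\<lambda>x. if P x then f x else g x)"
proof -
  have "computable1 (\<lambda>x. of_bool (P x) * f x + of_bool (\<not> P x) * g x)"
    using assms by (intro computable1_add computable1_mult computable1_of_bool decidable1_not)
  moreover have "(\<lambda>x. of_bool (P x) * f x + of_bool (\<not> P x) * g x) = (\<lambda>x. if P x then f x else g x)" by auto
  ultimately show ?thesis by simp
qed

lemma computable1_sum:
  assumes "computable1 b" "computable1 (\<lambda>z. F (nfst z) (nsnd z))"
  shows "computable1 (\<lambda>x. \<Sum>i<b x. F i x)"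
proof -
  have F: "computable1 (\<lambda>z. F (nfst z) (nsnd (nsnd z)))"
    using computable_compose2[OF assms(2), of nfst "\<lambda>z. nsnd (nsnd z)"]
    by (simp add: computable1_nfst_id computable1_nsnd computable1_nsnd_id)
  have "computable1 (\<lambda>x. rec_nat 0 (\<lambda>n r. r + F n x) (b x))"
    by (intro computable1_rec_nat computable1_const assms(1) computable1_add F
        computable1_nfst computable1_nsnd computable1_id)
  moreover have "rec_nat 0 (\<lambda>n r. r + F n x) k = (\<Sum>i<k. F i x)" for x k by (induction k) auto
  ultimately show ?thesis by simp
qed

lemma decidable1_ex_less:
  assumes "computable1 b" "decidable1 (\<lambda>z. Q (nfst z) (nsnd z))"
  shows "decidable1 (\<lambda>x. \<exists>i<b x. Q i x)"
proof -
  have "computable1 (\<lambda>x. \<Sum>i<b x. of_bool (Q i x))"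
    using assms by (intro computable1_sum) (simp_all add: decidable1_def)
  then have "decidable1 (\<lambda>x. 0 < (\<Sum>i<b x. of_bool (Q i x) :: nat))"
    by (intro decidable1_less computable1_const)
  moreover have "0 < (\<Sum>i<k. of_bool (Q i x) :: nat) \<longleftrightarrow> (\<exists>i<k. Q i x)" for k x
    by (induction k) (auto simp: less_Suc_eq)
  ultimately show ?thesis by simp
qed

lemma decidable1_all_less:
  assumes "computable1 b" "decidable1 (\<lambda>z. Q (nfst z) (nsnd z))"
  shows "decidable1 (\<lambda>x. \<forall>i<b x. Q i x)"
  using decidable1_not[OF decidable1_ex_less[OF assms(1), where Q = "\<lambda>i x. \<not> Q i x"]] decidable1_not[OF assms(2)]
  by simp

lemma computable1_Least:
  assumes "decidable1 (\<lambda>z. Q (nfst z) (nsnd z))" and "\<And>x. \<exists>y. Q y x"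
  shows "computable1 (\<lambda>x. LEAST y. Q y x)"
proof -
  have "computable2 (\<lambda>y x. of_bool (\<not> Q y x))"
    using decidable1_not[OF assms(1)] by (intro computable2I) (simp add: decidable1_def)
  moreover have "\<exists>y. of_bool (\<not> Q y x) = (0::nat)" for x using assms(2) by simp
  ultimately have "computable1 (\<lambda>x. LEAST y. of_bool (\<not> Q y x) = (0::nat))" by (rule computable1_Mn)
  then show ?thesis by simp
qed

lemma computable1_power: "computable1 f \<Longrightarrow> computable1 g \<Longrightarrow> computable1 (\<lambda>x. f x ^ g x)"
proof -
  have "computable1 (\<lambda>z. rec_nat 1 (\<lambda>_ r. nfst z * r) (nsnd z))"
    by (intro computable1_rec_nat computable1_const computable1_mult computable1_nfst
        computable1_nsnd computable1_id)
  moreover have "rec_nat 1 (\<lambda>_ r. x * r) n = x ^ n" for x n :: nat by (induction n) auto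
  ultimately have "computable1 (\<lambda>z. nfst z ^ nsnd z)" by simp
  from computable_compose2[OF this] show "computable1 f \<Longrightarrow> computable1 g \<Longrightarrow> computable1 (\<lambda>x. f x ^ g x)" .
qed

text \<open>The quotient counts the positive multiples of \<open>y\<close> that are at most
  \<open>x\<close>, which turns division into a bounded sum.\<close>

lemma div_eq_sum: "x div y = (if y = 0 then 0 else \<Sum>q<x. of_bool (Suc q * y \<le> x))" for x y :: nat
proof (cases "y = 0")
  case False
  then have "{..<x} \<inter> {q. Suc q * y \<le> x} = {..<x div y}"
    using less_eq_div_iff_mult_less_eq[of y "Suc _" x]
    by (auto simp: Suc_le_eq intro: less_le_trans[OF _ div_le_dividend] simp del: mult_Suc)
  then show ?thesis using False by (simp add: of_bool_def sum.If_cases)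
qed auto

lemma computable1_div: "computable1 f \<Longrightarrow> computable1 g \<Longrightarrow> computable1 (\<lambda>x. f x div g x)"
proof -
  have "computable1 (\<lambda>z. nfst z div nsnd z)"
    unfolding div_eq_sum
    by (intro computable1_sum computable1_If computable1_const computable1_mult computable1_nfst
        computable1_nsnd computable1_id decidable1_eq decidable1_le computable1_Suc computable1_of_bool)
  from computable_compose2[OF this] show "computable1 f \<Longrightarrow> computable1 g \<Longrightarrow> computable1 (\<lambda>x. f x div g x)" .
qed

lemma computable1_mod: "computable1 f \<Longrightarrow> computable1 g \<Longrightarrow> computable1 (\<lambda>x. f x mod g x)"
  unfolding minus_mult_div_eq_mod[symmetric]
  by (intro computable1_diff computable1_mult computable1_div)

lemmas computable_intros =
  computable1_id computable1_const computable1_Suc computable1_add computable1_diff computable1_mult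
  computable1_npair computable1_nfst computable1_nsnd computable1_rec_nat computable1_of_bool
  computable1_If computable1_sum computable1_power computable1_div computable1_mod
  decidable1_not decidable1_conj decidable1_disj decidable1_imp decidable1_le decidable1_less
  decidable1_eq decidable1_ex_less decidable1_all_less

lemmas decidable_compose3 =
  computable_compose3[where F = "\<lambda>x y z. of_bool (P x y z)" for P, folded decidable1_def]
lemmas decidable_compose4 =
  computable_compose4[where F = "\<lambda>x y z u. of_bool (P x y z u)" for P, folded decidable1_def]
lemmas decidable_compose5 =
  computable_compose5[where F = "\<lambda>x y z u v. of_bool (P x y z u v)" for P, folded decidable1_def]


section \<open>A step-indexed evaluator\<close>

definition ncons :: "nat \<Rightarrow> nat \<Rightarrow> nat" where "ncons x c = Suc (npair x c)"
definition ntl :: "nat \<Rightarrow> nat" where "ntl c = nsnd (c - 1)"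
definition ndrop :: "nat \<Rightarrow> nat \<Rightarrow> nat" where "ndrop c i = rec_nat c (\<lambda>_. ntl) i"
definition nnth :: "nat \<Rightarrow> nat \<Rightarrow> nat" where "nnth c i = nfst (ndrop c i - 1)"
text \<open>As 0 codes the empty list, this is the number of tails that exhausts the list.\<close>

definition nlength :: "nat \<Rightarrow> nat" where "nlength c = (LEAST i. ndrop c i = 0)"

lemma ncons_list_encode [simp]: "ncons x (list_encode xs) = list_encode (x # xs)"
  by (simp add: ncons_def npair_def)

declare list_encode.simps(2) [simp del]

lemma ntl_list_encode [simp]: "ntl (list_encode xs) = list_encode (tl xs)"
proof -
  \<comment> \<open>For the empty list, \<open>ntl\<close> decodes the truncated difference
    \<open>0 - 1 = 0\<close>, so the tail of the empty list is again empty.\<close>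
  have "prod_decode 0 = (0, 0)"
    using prod_encode_inverse[of "(0, 0)"] by (simp add: prod_encode_def)
  then show ?thesis by (cases xs) (simp_all add: ntl_def nsnd_def list_encode.simps(2))
qed

lemma ndrop_list_encode [simp]: "ndrop (list_encode xs) i = list_encode (drop i xs)"
proof (induction i)
  case (Suc i)
  have "ndrop (list_encode xs) (Suc i) = ntl (ndrop (list_encode xs) i)" by (simp add: ndrop_def)
  then show ?case by (simp add: Suc.IH drop_Suc tl_drop)
qed (simp add: ndrop_def)

lemma nnth_list_encode [simp]: "i < length xs \<Longrightarrow> nnth (list_encode xs) i = xs ! i"
  by (simp add: nnth_def Cons_nth_drop_Suc[symmetric] list_encode.simps(2) flip: npair_def)

lemma nlength_list_encode [simp]: "nlength (list_encode xs) = length xs"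
proof -
  have "list_encode ys = 0 \<longleftrightarrow> ys = []" for ys by (cases ys) (auto simp: list_encode.simps(2))
  then show ?thesis unfolding nlength_def by (auto intro!: Least_equality)
qed

lemma computable1_ncons: "computable1 f \<Longrightarrow> computable1 g \<Longrightarrow> computable1 (\<lambda>x. ncons (f x) (g x))"
  unfolding ncons_def by (intro computable_intros)

lemma computable1_ntl: "computable1 f \<Longrightarrow> computable1 (\<lambda>x. ntl (f x))"
  unfolding ntl_def by (intro computable_intros)

lemma computable1_ndrop: "computable1 f \<Longrightarrow> computable1 g \<Longrightarrow> computable1 (\<lambda>x. ndrop (f x) (g x))"
proof -
  have "computable1 (\<lambda>z. ndrop (nfst z) (nsnd z))"
    unfolding ndrop_def by (intro computable_intros computable1_ntl)
  from computable_compose2[OF this] show "computable1 f \<Longrightarrow> computable1 g \<Longrightarrow> computable1 (\<lambda>x. ndrop (f x) (g x))" .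
qed

lemma computable1_nnth: "computable1 f \<Longrightarrow> computable1 g \<Longrightarrow> computable1 (\<lambda>x. nnth (f x) (g x))"
  unfolding nnth_def by (intro computable_intros computable1_ndrop)

lemma computable1_nlength: "computable1 f \<Longrightarrow> computable1 (\<lambda>x. nlength (f x))"
proof -
  have "\<exists>i. ndrop c i = 0" for c
    by (rule exI[of _ "length (list_decode c)"]) (metis drop_all list_decode_inverse list_encode.simps(1) ndrop_list_encode order_refl)
  then have "computable1 nlength"
    unfolding nlength_def[abs_def] by (intro computable1_Least computable_intros computable1_ndrop)
  from computable1_comp[OF this] show "computable1 f \<Longrightarrow> computable1 (\<lambda>x. nlength (f x))" .
qed

section \<open>Codes of programs and linear derivations\<close>

fun code :: "recf \<Rightarrow> nat" where
  "code Zero = npair 0 0"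
| "code Succ = npair 1 0"
| "code (Proj i) = npair 2 i"
| "code Oracle = npair 3 0"
| "code (Comp f gs) = npair 4 (npair (code f) (list_encode (map code gs)))"
| "code (Prec f g) = npair 5 (npair (code f) (code g))"
| "code (Mn f) = npair 6 (code f)"

definition entry :: "nat \<Rightarrow> nat \<Rightarrow> nat \<Rightarrow> nat" where
  "entry p xs y = npair p (npair xs y)"

lemma entry_simps [simp]:
  "nfst (entry p xs y) = p" "nfst (nsnd (entry p xs y)) = xs" "nsnd (nsnd (entry p xs y)) = y"
  by (simp_all add: entry_def)

text \<open>
  A derivation is a list in which every entry, asserting that a program has a value on some
  arguments, follows by one rule of \<^const>\<open>eval\<close> from entries later in the list. The
  predicate \<open>D\<close> holds of the available premises, and \<open>Q x b\<close> says that the oracle answers \<open>b\<close>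
  to the query \<open>x\<close>.
\<close>

definition justified :: "(nat \<Rightarrow> nat \<Rightarrow> bool) \<Rightarrow> (nat \<Rightarrow> bool) \<Rightarrow> nat \<Rightarrow> bool" where
  "justified Q D v \<longleftrightarrow>
    (nfst (nfst v) = 0 \<and> nsnd (nsnd v) = 0) \<or>
    (nfst (nfst v) = 1 \<and> nlength (nfst (nsnd v)) = 1 \<and> nsnd (nsnd v) = Suc (nnth (nfst (nsnd v)) 0)) \<or>
    (nfst (nfst v) = 2 \<and> nsnd (nfst v) < nlength (nfst (nsnd v)) \<and>
      nsnd (nsnd v) = nnth (nfst (nsnd v)) (nsnd (nfst v))) \<or>
    (nfst (nfst v) = 3 \<and> nlength (nfst (nsnd v)) = 1 \<and> Q (nnth (nfst (nsnd v)) 0) (nsnd (nsnd v))) \<or>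
    (nfst (nfst v) = 4 \<and> (\<exists>w. D w \<and> nfst w = nfst (nsnd (nfst v)) \<and> nsnd (nsnd w) = nsnd (nsnd v) \<and>
      nlength (nfst (nsnd w)) = nlength (nsnd (nsnd (nfst v))) \<and>
      (\<forall>l<nlength (nfst (nsnd w)).
        D (entry (nnth (nsnd (nsnd (nfst v))) l) (nfst (nsnd v)) (nnth (nfst (nsnd w)) l))))) \<or>
    (nfst (nfst v) = 5 \<and> 0 < nlength (nfst (nsnd v)) \<and> nnth (nfst (nsnd v)) 0 = 0 \<and>
      D (entry (nfst (nsnd (nfst v))) (ntl (nfst (nsnd v))) (nsnd (nsnd v)))) \<or>
    (nfst (nfst v) = 5 \<and> 0 < nlength (nfst (nsnd v)) \<and> 0 < nnth (nfst (nsnd v)) 0 \<and>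
      (\<exists>w. D w \<and> nfst w = nfst v \<and>
        nfst (nsnd w) = ncons (nnth (nfst (nsnd v)) 0 - 1) (ntl (nfst (nsnd v))) \<and>
        D (entry (nsnd (nsnd (nfst v)))
          (ncons (nnth (nfst (nsnd v)) 0 - 1) (ncons (nsnd (nsnd w)) (ntl (nfst (nsnd v)))))
          (nsnd (nsnd v))))) \<or>
    (nfst (nfst v) = 6 \<and> D (entry (nsnd (nfst v)) (ncons (nsnd (nsnd v)) (nfst (nsnd v))) 0) \<and>
      (\<forall>m<nsnd (nsnd v). \<exists>w. D w \<and> nfst w = nsnd (nfst v) \<and>
        nfst (nsnd w) = ncons m (nfst (nsnd v)) \<and> 0 < nsnd (nsnd w)))"

text \<open>The premises \<open>D\<close> occur only positively in \<open>justified\<close>.\<close>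

lemma justified_mono:
  assumes "justified Q D v" and "\<And>w. D w \<Longrightarrow> D' w"
  shows "justified Q D' v"
  using assms(1) unfolding justified_def
  by (elim disj_forward conj_forward ex_forward all_forward imp_forward) (assumption | erule assms(2))+

lemma eq_entryI: "nfst w = p \<Longrightarrow> nfst (nsnd w) = xs \<Longrightarrow> nsnd (nsnd w) = y \<Longrightarrow> w = entry p xs y"
  by (metis entry_def npair_nfst_nsnd)

text \<open>The tag of \<open>code p\<close> leaves only the disjuncts for its constructor. A
  premise \<open>w\<close> supplied by a disjunct is always an \<open>entry\<close> of the expected
  form, because every number codes a list.\<close>

lemma justified_sound:
  assumes just: "justified Q D (entry (code p) (list_encode xs) y)"
    and D: "\<And>p xs y. D (entry (code p) (list_encode xs) y) \<Longrightarrow> eval X p xs y"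
    and Q: "\<And>x b. Q x b \<Longrightarrow> b = of_bool (x \<in> X)"
  shows "eval X p xs y"
proof (cases p)
  case Zero
  then show ?thesis using just by (simp add: justified_def eval_Zero)
next
  case Succ
  then show ?thesis using just by (auto simp: justified_def length_Suc_conv intro: eval_Succ)
next
  case (Proj i)
  then show ?thesis using just by (auto simp: justified_def intro: eval_Proj)
next
  case Oracle
  then obtain x where x: "xs = [x]" "Q x y"
    using just by (auto simp: justified_def length_Suc_conv)
  then show ?thesis using eval_Oracle[of X x] Q[OF x(2)] Oracle by simp
next
  case (Comp f gs)
  then obtain w where w: "D w" "nfst w = code f" "nsnd (nsnd w) = y"
      "nlength (nfst (nsnd w)) = length gs"
      "\<forall>l<length gs. D (entry (nnth (list_encode (map code gs)) l) (list_encode xs) (nnth (nfst (nsnd w)) l))"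
    using just by (auto simp: justified_def)
  obtain ys where ys: "nfst (nsnd w) = list_encode ys" by (metis list_decode_inverse)
  have "w = entry (code f) (list_encode ys) y" using w ys by (intro eq_entryI)
  then have "eval X f ys y" using w(1) D by blast
  moreover have "list_all2 (\<lambda>g y. eval X g xs y) gs ys"
    using w(4,5) D by (auto simp: list_all2_conv_all_nth ys)
  ultimately show ?thesis unfolding Comp by (rule eval_Comp[rotated])
next
  case (Prec f g)
  then have "xs \<noteq> []" using just by (auto simp: justified_def)
  then obtain n zs where xs: "xs = n # zs" by (cases xs) auto
  show ?thesis
  proof (cases n)
    case 0
    then show ?thesis using just D Prec xs by (auto simp: justified_def intro: eval_Prec_0)
  next
    case (Suc m)
    then obtain w where w: "D w" "nfst w = code p" "nfst (nsnd w) = list_encode (m # zs)"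
      and g: "D (entry (code g) (list_encode (m # nsnd (nsnd w) # zs)) y)"
      using just Prec xs by (auto simp: justified_def)
    have "w = entry (code p) (list_encode (m # zs)) (nsnd (nsnd w))" using w by (intro eq_entryI) auto
    then have "eval X p (m # zs) (nsnd (nsnd w))" using w(1) D by metis
    then show ?thesis using D[OF g] unfolding xs Suc Prec by (rule eval_Prec_Suc)
  qed
next
  case (Mn f)
  then have f: "D (entry (code f) (list_encode (y # xs)) 0)"
    and less: "\<And>m. m < y \<Longrightarrow> \<exists>w. D w \<and> nfst w = code f \<and> nfst (nsnd w) = list_encode (m # xs) \<and> 0 < nsnd (nsnd w)"
    using just by (auto simp: justified_def)
  have "\<exists>k. eval X f (m # xs) (Suc k)" if "m < y" for m
  proof -
    from less[OF that] obtain w where w: "D w" "nfst w = code f" "nfst (nsnd w) = list_encode (m # xs)" "0 < nsnd (nsnd w)"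
      by blast
    have "w = entry (code f) (list_encode (m # xs)) (Suc (nsnd (nsnd w) - 1))" using w by (intro eq_entryI) auto
    then show ?thesis using w(1) D by metis
  qed
  then show ?thesis unfolding Mn by (intro eval_Mn D[OF f])
qed

fun derivation :: "(nat \<Rightarrow> nat \<Rightarrow> bool) \<Rightarrow> nat list \<Rightarrow> bool" where
  "derivation Q [] \<longleftrightarrow> True"
| "derivation Q (v # ds) \<longleftrightarrow> justified Q (\<lambda>w. w \<in> set ds) v \<and> derivation Q ds"

lemma derivation_append: "derivation Q ds \<Longrightarrow> derivation Q es \<Longrightarrow> derivation Q (ds @ es)"
  by (induction ds) (auto elim!: justified_mono)

lemma derivation_sound:
  assumes "derivation Q ds" "entry (code p) (list_encode xs) y \<in> set ds"
    and "\<And>x b. Q x b \<Longrightarrow> b = of_bool (x \<in> X)"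
  shows "eval X p xs y"
  using assms(1,2)
proof (induction ds arbitrary: p xs y)
  case (Cons v ds)
  show ?case
  proof (cases "entry (code p) (list_encode xs) y \<in> set ds")
    case True
    then show ?thesis using Cons by simp
  next
    case False
    then have "justified Q (\<lambda>w. w \<in> set ds) (entry (code p) (list_encode xs) y)"
      using Cons.prems by auto
    then show ?thesis
      by (rule justified_sound) (use Cons assms(3) in auto)
  qed
qed simp

definition derivable :: "(nat \<Rightarrow> nat \<Rightarrow> bool) \<Rightarrow> nat \<Rightarrow> bool" where
  "derivable Q v \<longleftrightarrow> (\<exists>ds. derivation Q ds \<and> v \<in> set ds)"

text \<open>Derivations of the finitely many premises are concatenated, and the conclusion is put in
  front.\<close>

lemma derivableI:
  assumes "finite F" and "\<And>w. w \<in> F \<Longrightarrow> derivable Q w" and "justified Q (\<lambda>w. w \<in> F) v"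
  shows "derivable Q v"
proof -
  have "\<exists>ds. derivation Q ds \<and> F \<subseteq> set ds"
    using assms(1,2)
  proof (induction F)
    case empty
    show ?case by (rule exI[of _ "[]"]) simp
  next
    case (insert w F)
    then obtain ds es where "derivation Q ds" "F \<subseteq> set ds" "derivation Q es" "w \<in> set es"
      unfolding derivable_def by blast
    then show ?case by (intro exI[of _ "es @ ds"]) (auto intro: derivation_append)
  qed
  then obtain ds where "derivation Q ds" "F \<subseteq> set ds" by blast
  then have "derivation Q (v # ds)" using assms(3) by (auto elim: justified_mono)
  then show ?thesis unfolding derivable_def by (intro exI[of _ "v # ds"]) auto
qed

text \<open>Completeness of derivations. Every rule of \<open>eval\<close> has finitely many
  premises; for \<open>Mn\<close> these are the values at the arguments up to the one found.\<close>

lemma eval_derivable: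
  "eval X p xs y \<Longrightarrow> derivable (\<lambda>x b. b = of_bool (x \<in> X)) (entry (code p) (list_encode xs) y)"
proof (induction rule: eval.induct)
  case (eval_Zero xs)
  show ?case by (rule derivableI[of "{}"]) (auto simp: justified_def)
next
  case (eval_Succ x)
  show ?case by (rule derivableI[of "{}"]) (auto simp: justified_def)
next
  case (eval_Proj i xs)
  then show ?case by - (rule derivableI[of "{}"], auto simp: justified_def)
next
  case (eval_Oracle x)
  show ?case by (rule derivableI[of "{}"]) (auto simp: justified_def)
next
  case (eval_Comp xs gs ys f z)
  let ?w = "entry (code f) (list_encode ys) z"
  let ?g = "\<lambda>l. entry (code (gs ! l)) (list_encode xs) (ys ! l)"
  have len: "length gs = length ys" using eval_Comp(1) by (auto dest: list_all2_lengthD)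
  show ?case
  proof (rule derivableI[of "insert ?w (?g ` {..<length gs})"])
    show "justified (\<lambda>x b. b = of_bool (x \<in> X)) (\<lambda>w. w \<in> insert ?w (?g ` {..<length gs}))
      (entry (code (Comp f gs)) (list_encode xs) z)"
      using len by (auto simp: justified_def intro!: exI[of _ ?w])
  qed (use eval_Comp in \<open>auto simp: list_all2_conv_all_nth\<close>)
next
  case (eval_Prec_0 f xs y g)
  then show ?case
    by - (rule derivableI[of "{entry (code f) (list_encode xs) y}"], auto simp: justified_def)
next
  case (eval_Prec_Suc f g n xs r y)
  let ?w = "entry (code (Prec f g)) (list_encode (n # xs)) r"
  show ?case
    by (rule derivableI[of "{?w, entry (code g) (list_encode (n # r # xs)) y}"])
      (use eval_Prec_Suc.IH in \<open>auto simp: justified_def intro!: exI[of _ ?w]\<close>)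
next
  case (eval_Mn f n xs)
  then obtain k where k: "\<And>m. m < n \<Longrightarrow> derivable (\<lambda>x b. b = of_bool (x \<in> X)) (entry (code f) (list_encode (m # xs)) (Suc (k m)))"
    by metis
  let ?g = "\<lambda>m. entry (code f) (list_encode (m # xs)) (Suc (k m))"
  show ?case
  proof (rule derivableI[of "insert (entry (code f) (list_encode (n # xs)) 0) (?g ` {..<n})"])
    show "justified (\<lambda>x b. b = of_bool (x \<in> X)) (\<lambda>w. w \<in> insert (entry (code f) (list_encode (n # xs)) 0) (?g ` {..<n}))
      (entry (code (Mn f)) (list_encode xs) n)"
      unfolding justified_def by (intro disjI2) (auto intro!: exI[of _ "?g _"])
  qed (use eval_Mn k in auto)
qed

text \<open>Membership in the rest of the list becomes a search over later positions, bounded by the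
  length; \<open>steps_eq\<close> needs this form for decidability.\<close>

lemma derivation_nth:
  "derivation Q ds \<longleftrightarrow> (\<forall>i<length ds. justified Q (\<lambda>w. \<exists>j<length ds. i < j \<and> ds ! j = w) (ds ! i))"
proof (induction ds)
  case (Cons v ds)
  have "(\<lambda>w. \<exists>j<length (v # ds). 0 < j \<and> (v # ds) ! j = w) = (\<lambda>w. w \<in> set ds)"
    by (auto simp: Ex_less_Suc2 in_set_conv_nth fun_eq_iff)
  moreover have "(\<lambda>w. \<exists>j<length (v # ds). Suc i < j \<and> (v # ds) ! j = w) = (\<lambda>w. \<exists>j<length ds. i < j \<and> ds ! j = w)" for i
    by (auto simp: Ex_less_Suc2 fun_eq_iff)
  ultimately show ?case
    using Cons.IH by (simp add: All_less_Suc2)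
qed simp

section \<open>Computations with a finite oracle string\<close>

definition nbit :: "nat \<Rightarrow> nat \<Rightarrow> nat" where
  "nbit \<tau> i = \<tau> div 2 ^ i mod 2"

lemma computable1_nbit: "computable1 f \<Longrightarrow> computable1 g \<Longrightarrow> computable1 (\<lambda>x. nbit (f x) (g x))"
  unfolding nbit_def by (intro computable_intros)

text \<open>
  The oracle is the string of length \<open>s\<close> whose characteristic function is given by the lowest
  \<open>s\<close> bits of \<open>\<tau>\<close>.
\<close>

definition steps :: "nat \<Rightarrow> nat \<Rightarrow> nat \<Rightarrow> nat \<Rightarrow> nat \<Rightarrow> bool" where
  "steps s \<tau> p xs y \<longleftrightarrow>
    (\<exists>d<s. derivation (\<lambda>x b. x < s \<and> b = nbit \<tau> x) (list_decode d) \<and> entry p xs y \<in> set (list_decode d))"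

lemma steps_eq:
  "steps s \<tau> p xs y \<longleftrightarrow>
    (\<exists>d<s. (\<forall>i<nlength d. justified (\<lambda>x b. x < s \<and> b = nbit \<tau> x)
        (\<lambda>w. \<exists>j<nlength d. i < j \<and> nnth d j = w) (nnth d i)) \<and>
      (\<exists>i<nlength d. nnth d i = entry p xs y))"
proof -
  have len: "nlength d = length (list_decode d)" for d
    using nlength_list_encode[of "list_decode d"] by simp
  have nth: "nnth d i = list_decode d ! i" if "i < nlength d" for d i
    using nnth_list_encode[of i "list_decode d"] that by (simp add: len)
  have "derivation Q (list_decode d) \<longleftrightarrow>
      (\<forall>i<nlength d. justified Q (\<lambda>w. \<exists>j<nlength d. i < j \<and> nnth d j = w) (nnth d i))" for Q d
    unfolding derivation_nth len[symmetric] by (simp add: nth cong: conj_cong)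
  moreover have "v \<in> set (list_decode d) \<longleftrightarrow> (\<exists>i<nlength d. nnth d i = v)" for v d
    by (auto simp: in_set_conv_nth len nth)
  ultimately show ?thesis unfolding steps_def by simp
qed

lemma decidable1_steps:
  assumes "computable1 s" "computable1 \<tau>" "computable1 p" "computable1 xs" "computable1 y"
  shows "decidable1 (\<lambda>x. steps (s x) (\<tau> x) (p x) (xs x) (y x))"
proof -
  \<comment> \<open>The quantifier over premises \<open>w\<close> in \<open>justified\<close> is
    unbounded; this collapses it to one over positions in the derivation.\<close>
  have ex: "(\<exists>w. (\<exists>j<k. i < j \<and> f j = w) \<and> P w) \<longleftrightarrow> (\<exists>j<k. i < j \<and> P (f j))"
    for k i :: nat and f :: "nat \<Rightarrow> nat" and P by blast
  have "decidable1 (\<lambda>z. steps (nfst z) (nfst (nsnd z)) (nfst (nsnd (nsnd z)))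
      (nfst (nsnd (nsnd (nsnd z)))) (nsnd (nsnd (nsnd (nsnd z)))))"
    unfolding steps_eq justified_def ex entry_def
    by (intro computable_intros computable1_nlength computable1_nnth computable1_ncons
        computable1_ntl computable1_nbit)
  from decidable_compose5[OF this assms] show ?thesis .
qed


section \<open>Limits of computable approximations\<close>

text \<open>The easy direction of the limit lemma: since the limit exists, membership in
  \<open>Y\<close> means \<open>R x s\<close> for almost all \<open>s\<close>, and equally
  \<open>R x s\<close> for infinitely many \<open>s\<close>.\<close>

lemma delta02_limit:
  assumes R: "decidable1 (\<lambda>z. R (nfst z) (nsnd z))"
    and lim: "\<And>x. \<forall>\<^sub>F s in sequentially. R x s \<longleftrightarrow> x \<in> Y"
  shows "delta02 Y"
proof -
  have R3: "decidable1 (\<lambda>z. R (nfst z) (nsnd (nsnd z)))"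
    using computable_compose2[where F = "\<lambda>x y. of_bool (R x y)", folded decidable1_def, OF R,
        of nfst "\<lambda>z. nsnd (nsnd z)"]
    by (simp add: computable1_nfst_id computable1_nsnd computable1_nsnd_id)
  have "sigma02 Y"
    unfolding sigma02_def
  proof (intro exI[of _ "\<lambda>x y z. y \<le> z \<longrightarrow> R x z"] conjI allI iffI)
    show "computable_rel3 (\<lambda>x y z. y \<le> z \<longrightarrow> R x z)"
      by (intro computable_rel3I computable_intros R3)
  next
    fix x assume "x \<in> Y" then show "\<exists>y. \<forall>z. y \<le> z \<longrightarrow> R x z"
      using lim[of x] by (simp add: eventually_sequentially)
  next
    fix x assume "\<exists>y. \<forall>z. y \<le> z \<longrightarrow> R x z" then show "x \<in> Y"
      using lim[of x] unfolding eventually_sequentially by (meson nat_le_linear)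
  qed
  moreover have "pi02 Y"
    unfolding pi02_def
  proof (intro exI[of _ "\<lambda>x y z. y \<le> z \<and> R x z"] conjI allI iffI)
    show "computable_rel3 (\<lambda>x y z. y \<le> z \<and> R x z)"
      by (intro computable_rel3I computable_intros R3)
  next
    fix x y assume "x \<in> Y" then show "\<exists>z. y \<le> z \<and> R x z"
      using lim[of x] unfolding eventually_sequentially by (meson nat_le_linear)
  next
    fix x assume "\<forall>y. \<exists>z. y \<le> z \<and> R x z" then show "x \<in> Y"
      using lim[of x] unfolding eventually_sequentially by meson
  qed
  ultimately show ?thesis by (simp add: delta02_def)
qed


section \<open>Avoiding small open sets\<close>

text \<open>A string of length \<open>s\<close> is a number below \<open>2 ^ s\<close> with the bit
  of position 0 least significant. Restricting a string to its first \<open>k\<close> bits is then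
  reduction modulo \<open>2 ^ k\<close>.\<close>

definition prefix_code :: "nat set \<Rightarrow> nat \<Rightarrow> nat" where
  "prefix_code Y s = (\<Sum>i<s. of_bool (i \<in> Y) * 2 ^ i)"

lemma prefix_code_0 [simp]: "prefix_code Y 0 = 0"
  and prefix_code_Suc: "prefix_code Y (Suc s) = prefix_code Y s + of_bool (s \<in> Y) * 2 ^ s"
  by (simp_all add: prefix_code_def)

lemma prefix_code_less: "prefix_code Y s < 2 ^ s"
proof (induction s)
  case (Suc s)
  have "of_bool (s \<in> Y) * 2 ^ s \<le> (2 ^ s :: nat)" by simp
  then show ?case using Suc unfolding prefix_code_Suc power_Suc by linarith
qed simp

lemma prefix_code_mod: "k \<le> s \<Longrightarrow> prefix_code Y s mod 2 ^ k = prefix_code Y k"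
proof (induction s rule: dec_induct)
  case base
  show ?case by (simp add: prefix_code_less)
next
  case (step s)
  have "(2 ^ s :: nat) = 2 ^ k * 2 ^ (s - k)" using step by (simp flip: power_add)
  then show ?case using step by (simp add: prefix_code_Suc)
qed

lemma mod_power_Suc: "\<tau> mod 2 ^ Suc k = \<tau> mod 2 ^ k + nbit \<tau> k * 2 ^ k"
  using mod_mult2_eq[of \<tau> "2 ^ k" 2] by (simp add: nbit_def mult.commute)

lemma nbit_less_2: "nbit \<tau> k < 2"
  by (simp add: nbit_def)

lemma nbit_cong:
  assumes "\<tau> mod 2 ^ s = \<tau>' mod 2 ^ s" "i < s" shows "nbit \<tau> i = nbit \<tau>' i"
proof -
  have "\<tau> mod 2 ^ k = \<tau>' mod 2 ^ k" if "k \<le> s" for k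
    using assms(1) that by (metis le_imp_power_dvd mod_mod_cancel)
  from this[of i] this[of "Suc i"] assms(2) show ?thesis
    unfolding mod_power_Suc by simp
qed

lemma nbit_mod: "i < s \<Longrightarrow> nbit (\<tau> mod 2 ^ s) i = nbit \<tau> i"
  by (rule nbit_cong[of _ s]) auto

lemma nbit_prefix_code: "i < s \<Longrightarrow> nbit (prefix_code Y s) i = of_bool (i \<in> Y)"
proof -
  assume "i < s"
  then have "prefix_code Y s mod 2 ^ Suc i = prefix_code Y i + of_bool (i \<in> Y) * 2 ^ i"
    by (simp only: prefix_code_mod Suc_le_eq prefix_code_Suc)
  moreover have "prefix_code Y s mod 2 ^ i = prefix_code Y i"
    using \<open>i < s\<close> by (simp add: prefix_code_mod)
  ultimately show ?thesis unfolding mod_power_Suc by simp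
qed

text \<open>Divided by \<open>2 ^ s\<close>, this is the measure of the clopen set given by the
  strings of length \<open>s\<close> in \<open>P\<close>. Writing it as a bounded sum makes it
  computable for decidable \<open>P\<close>.\<close>

definition string_count :: "(nat \<Rightarrow> bool) \<Rightarrow> nat \<Rightarrow> nat" where
  "string_count P s = (\<Sum>\<tau><2 ^ s. of_bool (P \<tau>))"

lemma string_count_mono: "(\<And>\<tau>. \<tau> < 2 ^ s \<Longrightarrow> P \<tau> \<Longrightarrow> Q \<tau>) \<Longrightarrow> string_count P s \<le> string_count Q s"
  unfolding string_count_def by (rule sum_mono) auto

lemma string_count_eq_card: "string_count P s = card {\<tau>. \<tau> < 2 ^ s \<and> P \<tau>}"
proof -
  have "{..<2 ^ s} \<inter> {\<tau>. P \<tau>} = {\<tau>. \<tau> < 2 ^ s \<and> P \<tau>}" by auto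
  then show ?thesis by (simp add: string_count_def of_bool_def sum.If_cases)
qed

lemma sum_lessThan_add: "(\<Sum>i<m + n. f i) = (\<Sum>i<m. f i) + (\<Sum>i<n. f (m + i :: nat) :: nat)"
  by (induction n) auto

lemma string_count_mod_Suc: "string_count (\<lambda>\<tau>. P (\<tau> mod 2 ^ s)) (Suc s) = 2 * string_count P s"
  using sum_lessThan_add[where m = "2 ^ s" and n = "2 ^ s" and f = "\<lambda>\<tau>. of_bool (P (\<tau> mod 2 ^ s))"]
  by (simp add: string_count_def mult_2)

lemma string_count_mod:
  "k \<le> s \<Longrightarrow> string_count (\<lambda>\<tau>. P (\<tau> mod 2 ^ k)) s = 2 ^ (s - k) * string_count P k"
proof (induction s rule: dec_induct)
  case base
  then show ?case by (auto simp: string_count_def intro!: sum.cong)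
next
  case (step s)
  have "(\<tau> mod 2 ^ s) mod 2 ^ k = \<tau> mod 2 ^ k" for \<tau> :: nat
    using step by (simp add: le_imp_power_dvd mod_mod_cancel)
  then have "string_count (\<lambda>\<tau>. P (\<tau> mod 2 ^ k)) (Suc s) = 2 * string_count (\<lambda>\<tau>. P (\<tau> mod 2 ^ k)) s"
    using string_count_mod_Suc[of "\<lambda>\<tau>. P (\<tau> mod 2 ^ k)" s] by simp
  then show ?case using step by (simp add: Suc_diff_le)
qed

text \<open>Each string has two extensions by one bit. If both are kept at the next stage, the
  measure does not decrease.\<close>

lemma string_count_double:
  assumes "\<And>\<tau>. \<tau> < 2 ^ Suc s \<Longrightarrow> P (\<tau> mod 2 ^ s) \<Longrightarrow> Q \<tau>"
  shows "2 * string_count P s \<le> string_count Q (Suc s)"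
  unfolding string_count_mod_Suc[symmetric] using assms by (intro string_count_mono)

section \<open>Construction of a set avoiding all small open sets\<close>

text \<open>
  \<open>V i s\<close> is the set of strings of length \<open>s\<close> whose cylinders form the approximation at stage \<open>s\<close>
  to an open set; for each \<open>i\<close> the approximation is increasing from some stage on, but this stage
  need not be computable from \<open>i\<close>. The open set is to be avoided if its measure is at most
  \<open>2\<close> to the power \<open>- (2 * i + 2)\<close>.
\<close>

locale avoidance =
  fixes V :: "nat \<Rightarrow> nat \<Rightarrow> nat \<Rightarrow> bool"
  assumes decidable_V: "decidable1 (\<lambda>z. V (nfst z) (nfst (nsnd z)) (nsnd (nsnd z)))"
    and eventually_mono_V:
      "\<And>i. \<forall>\<^sub>F s in sequentially. \<forall>\<tau><2 ^ Suc s. V i s (\<tau> mod 2 ^ s) \<longrightarrow> V i (Suc s) \<tau>"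
begin

text \<open>Emptying the set at stages where it is too large keeps the measures of all
  \<open>B i s\<close> together below 1, at every stage.\<close>

definition B :: "nat \<Rightarrow> nat \<Rightarrow> nat \<Rightarrow> bool" where
  "B i s \<tau> \<longleftrightarrow> V i s \<tau> \<and> string_count (V i s) s * 2 ^ (2 * i + 2) \<le> 2 ^ s"

text \<open>For \<open>k \<le> s\<close> and after division by \<open>2 ^ s\<close>, the measure of
  \<open>B i s\<close> inside the cylinder of the string \<open>\<sigma>\<close> of length
  \<open>k\<close>.\<close>

definition N :: "nat \<Rightarrow> nat \<Rightarrow> nat \<Rightarrow> nat \<Rightarrow> nat" where
  "N i s k \<sigma> = string_count (\<lambda>\<tau>. B i s \<tau> \<and> \<tau> mod 2 ^ k = \<sigma>) s"

text \<open>As strings of length \<open>Suc k\<close>, the numbers \<open>\<sigma>\<close> and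
  \<open>\<sigma> + 2 ^ k\<close> extend \<open>\<sigma>\<close> by 0 and by 1. The test says that
  in the cylinder of the first one the sets with index below \<open>k\<close> have conditional
  measures adding up to at most 1 minus \<open>2\<close> to the power \<open>- k\<close>.\<close>

definition extend :: "nat \<Rightarrow> nat \<Rightarrow> nat \<Rightarrow> nat" where
  "extend s k \<sigma> =
    (if 2 ^ (2 * k + 1) * (\<Sum>i<k. N i s (Suc k) \<sigma>) \<le> (2 ^ k - 1) * 2 ^ s then \<sigma> else \<sigma> + 2 ^ k)"

definition approx :: "nat \<Rightarrow> nat \<Rightarrow> nat" where
  "approx s k = rec_nat 0 (extend s) k"

lemma approx_0 [simp]: "approx s 0 = 0"
  and approx_Suc [simp]: "approx s (Suc k) = extend s k (approx s k)"
  by (simp_all add: approx_def)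

lemma computable1_approx: "computable1 f \<Longrightarrow> computable1 g \<Longrightarrow> computable1 (\<lambda>x. approx (f x) (g x))"
proof -
  note V = decidable_compose3[OF decidable_V]
  have "computable1 (\<lambda>z. string_count (V (nfst z) (nsnd z)) (nsnd z))"
    unfolding string_count_def by (intro computable_intros V)
  note size = computable_compose2[where F = "\<lambda>i s. string_count (V i s) s", OF this]
  have "computable1 (\<lambda>z. N (nfst z) (nfst (nsnd z)) (nfst (nsnd (nsnd z))) (nsnd (nsnd (nsnd z))))"
    unfolding N_def B_def by (subst string_count_def) (intro computable_intros V size)
  note N = computable_compose4[where F = N, OF this]
  have "computable1 (\<lambda>z. extend (nfst z) (nfst (nsnd z)) (nsnd (nsnd z)))"
    unfolding extend_def by (intro computable_intros N)
  note extend = computable_compose3[where F = extend, OF this]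
  have "computable1 (\<lambda>z. approx (nfst z) (nsnd z))"
    unfolding approx_def by (intro computable_intros extend)
  from computable_compose2[OF this]
  show "computable1 f \<Longrightarrow> computable1 g \<Longrightarrow> computable1 (\<lambda>x. approx (f x) (g x))" .
qed

text \<open>Once \<open>V i\<close> is increasing, its measure is nondecreasing. So either it
  exceeds the bound at some stage and then forever, or nothing is cut off any more.\<close>

lemma large_or_eventually_eq:
  "(\<forall>\<^sub>F s in sequentially. 2 ^ s < string_count (V i s) s * 2 ^ (2 * i + 2)) \<or>
   (\<forall>\<^sub>F s in sequentially. B i s = V i s)"
proof -
  obtain s0 where s0: "\<And>s \<tau>. s0 \<le> s \<Longrightarrow> \<tau> < 2 ^ Suc s \<Longrightarrow> V i s (\<tau> mod 2 ^ s) \<Longrightarrow> V i (Suc s) \<tau>"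
    using eventually_mono_V[of i] unfolding eventually_sequentially by blast
  show ?thesis
  proof (cases "\<exists>s1\<ge>s0. 2 ^ s1 < string_count (V i s1) s1 * 2 ^ (2 * i + 2)")
    case True
    then obtain s1 where s1: "s0 \<le> s1" "2 ^ s1 < string_count (V i s1) s1 * 2 ^ (2 * i + 2)" by blast
    have "2 ^ s < string_count (V i s) s * 2 ^ (2 * i + 2)" if "s1 \<le> s" for s
      using that
    proof (induction s rule: dec_induct)
      case (step s)
      then have "2 * string_count (V i s) s \<le> string_count (V i (Suc s)) (Suc s)"
        using s0 s1(1) by (intro string_count_double) simp
      then have "2 * string_count (V i s) s * 2 ^ (2 * i + 2) \<le> string_count (V i (Suc s)) (Suc s) * 2 ^ (2 * i + 2)"
        by (rule mult_le_mono1)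
      with step.IH show ?case unfolding power_Suc[of 2 s] by linarith
    qed (rule s1(2))
    then show ?thesis unfolding eventually_sequentially by blast
  next
    case False
    then have "B i s = V i s" if "s0 \<le> s" for s using that by (auto simp: B_def fun_eq_iff not_less)
    then show ?thesis unfolding eventually_sequentially by blast
  qed
qed

text \<open>If \<open>V i\<close> becomes too large, \<open>B i s\<close> is eventually empty and
  the claim is vacuous; otherwise it is inherited from \<open>V\<close>.\<close>

lemma eventually_mono_B:
  "\<forall>\<^sub>F s in sequentially. \<forall>\<tau><2 ^ Suc s. B i s (\<tau> mod 2 ^ s) \<longrightarrow> B i (Suc s) \<tau>"
  using large_or_eventually_eq[of i]
proof
  assume "\<forall>\<^sub>F s in sequentially. 2 ^ s < string_count (V i s) s * 2 ^ (2 * i + 2)"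
  then show ?thesis by eventually_elim (simp add: B_def)
next
  assume *: "\<forall>\<^sub>F s in sequentially. B i s = V i s"
  then have "\<forall>\<^sub>F s in sequentially. B i (Suc s) = V i (Suc s)"
    by (rule eventually_sequentially_Suc[THEN iffD2])
  with * eventually_mono_V[of i] show ?thesis by eventually_elim simp
qed

lemma count_B: "string_count (B i s) s * 2 ^ (2 * i + 2) \<le> 2 ^ s"
proof (cases "string_count (V i s) s * 2 ^ (2 * i + 2) \<le> 2 ^ s")
  case True
  then have "B i s = V i s" by (simp add: B_def fun_eq_iff)
  then show ?thesis using True by simp
qed (simp add: B_def string_count_def)

lemma N_split: "N i s k \<sigma> = N i s (Suc k) \<sigma> + N i s (Suc k) (\<sigma> + 2 ^ k)" if "\<sigma> < 2 ^ k"
proof -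
  have "of_bool (B i s \<tau> \<and> \<tau> mod 2 ^ k = \<sigma>) =
      (of_bool (B i s \<tau> \<and> \<tau> mod 2 ^ Suc k = \<sigma>) + of_bool (B i s \<tau> \<and> \<tau> mod 2 ^ Suc k = \<sigma> + 2 ^ k) :: nat)" for \<tau>
  proof -
    have "nbit \<tau> k = 0 \<or> nbit \<tau> k = 1" using nbit_less_2[of \<tau> k] by linarith
    moreover have "\<tau> mod 2 ^ k < 2 ^ k" by simp
    ultimately show ?thesis using that unfolding mod_power_Suc by (elim disjE) (auto simp del: mod_less_divisor)
  qed
  then show ?thesis by (simp add: N_def string_count_def sum.distrib)
qed

lemma N_le: "N i s k \<sigma> \<le> string_count (B i s) s"
  unfolding N_def by (rule string_count_mono) simp

lemma eventually_double_load:
  "\<forall>\<^sub>F s in sequentially. 2 * (\<Sum>i<n. N i s k \<sigma>) \<le> (\<Sum>i<n. N i (Suc s) k \<sigma>)"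
proof -
  have "\<forall>\<^sub>F s in sequentially. \<forall>i\<in>{..<n}. 2 * N i s k \<sigma> \<le> N i (Suc s) k \<sigma>"
  proof (intro eventually_ball_finite ballI)
    fix i
    show "\<forall>\<^sub>F s in sequentially. 2 * N i s k \<sigma> \<le> N i (Suc s) k \<sigma>"
      using eventually_mono_B[of i] eventually_ge_at_top[of k]
    proof eventually_elim
      case (elim s)
      have "(\<tau> mod 2 ^ s) mod 2 ^ k = \<tau> mod 2 ^ k" for \<tau> :: nat
        using elim(2) by (simp add: le_imp_power_dvd mod_mod_cancel)
      then show ?case using elim(1) unfolding N_def by (intro string_count_double) auto
    qed
  qed simp
  then show ?thesis by eventually_elim (unfold sum_distrib_left, rule sum_mono, blast)
qed

text \<open>
  Each test is stable in the limit because the measure it compares to a constant is eventually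
  nondecreasing. If the measure conditional on the left extension exceeds the bound, then the
  one conditional on the right extension is below it, as their average is.
\<close>

lemma approx_limit:
  "\<exists>\<sigma><2 ^ k. \<forall>\<^sub>F s in sequentially.
    approx s k = \<sigma> \<and> 2 ^ (2 * k) * (\<Sum>i<k. N i s k \<sigma>) \<le> (2 ^ k - 1) * 2 ^ s"
proof (induction k)
  case 0
  show ?case by simp
next
  case (Suc k)
  then obtain \<sigma> where \<sigma>: "\<sigma> < 2 ^ k"
    and lim: "\<forall>\<^sub>F s in sequentially. approx s k = \<sigma> \<and> 2 ^ (2 * k) * (\<Sum>i<k. N i s k \<sigma>) \<le> (2 ^ k - 1) * 2 ^ s"
    by blast
  define L where "L s \<rho> = 2 ^ (2 * k + 1) * (\<Sum>i<k. N i s (Suc k) \<rho>)" for s \<rho>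
  \<comment> \<open>The longer string must also account for the set with index \<open>k\<close>. Its
    measure, at most \<open>2\<close> to the power \<open>- (2 * k + 2)\<close>, is at most
    \<open>2\<close> to the power \<open>- Suc k\<close> relative to a cylinder of length
    \<open>Suc k\<close>; that is the gap between the bounds for \<open>k\<close> and
    \<open>Suc k\<close>.\<close>
  have bound: "2 ^ (2 * Suc k) * (\<Sum>i<Suc k. N i s (Suc k) \<rho>) \<le> (2 ^ Suc k - 1) * 2 ^ s"
    if "L s \<rho> \<le> (2 ^ k - 1) * 2 ^ s" for s \<rho>
  proof -
    have "2 ^ (2 * k + 2) * N k s (Suc k) \<rho> \<le> 2 ^ s"
      using order_trans[OF mult_le_mono2[OF N_le] count_B[of k s, unfolded mult.commute[of "string_count _ _"]]] .
    moreover have "2 ^ (2 * Suc k) * (\<Sum>i<Suc k. N i s (Suc k) \<rho>) = 2 * L s \<rho> + 2 ^ (2 * k + 2) * N k s (Suc k) \<rho>"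
      by (simp add: L_def algebra_simps)
    moreover have "(2 ^ Suc k - 1) * 2 ^ s = 2 * ((2 ^ k - 1) * 2 ^ s) + (2 ^ s :: nat)"
    proof -
      obtain m where "2 ^ k = Suc m" using not0_implies_Suc[of "2 ^ k"] by auto
      then show ?thesis by (simp add: algebra_simps)
    qed
    ultimately show ?thesis using that by linarith
  qed
  obtain s0 where s0: "\<forall>s\<ge>s0. 2 * (\<Sum>i<k. N i s (Suc k) \<sigma>) \<le> (\<Sum>i<k. N i (Suc s) (Suc k) \<sigma>)"
    using eventually_double_load[of "Suc k" \<sigma> k] unfolding eventually_sequentially by (rule exE)
  have double: "2 * L s \<sigma> \<le> L (Suc s) \<sigma>" if "s0 \<le> s" for s
    using mult_le_mono2[OF s0[rule_format, OF that], of "2 ^ (2 * k + 1)"] by (simp add: L_def mult.left_commute)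
  show ?case
  proof (cases "\<exists>s1\<ge>s0. (2 ^ k - 1) * 2 ^ s1 < L s1 \<sigma>")
    case True
    then obtain s1 where s1: "s0 \<le> s1" "(2 ^ k - 1) * 2 ^ s1 < L s1 \<sigma>" by blast
    have large: "(2 ^ k - 1) * 2 ^ s < L s \<sigma>" if "s1 \<le> s" for s
      using that
    proof (induction s rule: dec_induct)
      case (step s)
      then show ?case using double[of s] s1(1) by simp
    qed (rule s1(2))
    have "\<forall>\<^sub>F s in sequentially. approx s (Suc k) = \<sigma> + 2 ^ k \<and>
        2 ^ (2 * Suc k) * (\<Sum>i<Suc k. N i s (Suc k) (\<sigma> + 2 ^ k)) \<le> (2 ^ Suc k - 1) * 2 ^ s"
      using lim eventually_ge_at_top[of s1]
    proof eventually_elim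
      case (elim s)
      have "2 * (2 ^ (2 * k) * (\<Sum>i<k. N i s k \<sigma>)) = L s \<sigma> + L s (\<sigma> + 2 ^ k)"
        unfolding N_split[OF \<sigma>] by (simp add: L_def sum.distrib algebra_simps)
      then have "L s (\<sigma> + 2 ^ k) \<le> (2 ^ k - 1) * 2 ^ s"
        using elim large[of s] by linarith
      then show ?case using elim large[of s] bound by (simp add: extend_def L_def del: sum.lessThan_Suc)
    qed
    then show ?thesis using \<sigma> by (intro exI[of _ "\<sigma> + 2 ^ k"]) simp
  next
    case False
    have "\<forall>\<^sub>F s in sequentially. approx s (Suc k) = \<sigma> \<and>
        2 ^ (2 * Suc k) * (\<Sum>i<Suc k. N i s (Suc k) \<sigma>) \<le> (2 ^ Suc k - 1) * 2 ^ s"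
      using lim eventually_ge_at_top[of s0]
    proof eventually_elim
      case (elim s)
      then have "L s \<sigma> \<le> (2 ^ k - 1) * 2 ^ s" using False by (simp add: not_less)
      then show ?case using elim bound by (simp add: extend_def L_def del: sum.lessThan_Suc)
    qed
    then show ?thesis using \<sigma> by (intro exI[of _ \<sigma>]) simp
  qed
qed

text \<open>The prefixes of \<open>Y\<close> are the limits of \<open>approx\<close>. If
  \<open>V i\<close> meets \<open>Y\<close> infinitely often without becoming large, then some
  prefix of \<open>Y\<close> lies in \<open>B i\<close> at a stage after which \<open>B i\<close>
  increases. So \<open>B i\<close> fills the whole cylinder of that prefix, against the bound below
  1 in \<open>approx_limit\<close>.\<close>

theorem avoiding_set:
  "\<exists>Y. delta02 Y \<and> (\<forall>i. (\<exists>\<^sub>F s in sequentially. V i s (prefix_code Y s)) \<longrightarrow>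
    (\<forall>\<^sub>F s in sequentially. 2 ^ s < string_count (V i s) s * 2 ^ (2 * i + 2)))"
proof -
  have "\<forall>k. \<exists>\<sigma>. \<sigma> < 2 ^ k \<and> (\<forall>\<^sub>F s in sequentially.
      approx s k = \<sigma> \<and> 2 ^ (2 * k) * (\<Sum>i<k. N i s k \<sigma>) \<le> (2 ^ k - 1) * 2 ^ s)"
    using approx_limit by blast
  from choice[OF this] obtain \<sigma> where less: "\<And>k. \<sigma> k < 2 ^ k"
    and lim: "\<And>k. \<forall>\<^sub>F s in sequentially.
      approx s k = \<sigma> k \<and> 2 ^ (2 * k) * (\<Sum>i<k. N i s k (\<sigma> k)) \<le> (2 ^ k - 1) * 2 ^ s"
    by auto
  define Y where "Y = {n. nbit (\<sigma> (Suc n)) n = 1}"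
  \<comment> \<open>The limit strings cohere: at a late stage \<open>approx\<close> has settled for
    \<open>k\<close> and \<open>Suc k\<close>, so the second limit extends the first by one
    bit.\<close>
  have "prefix_code Y k = \<sigma> k" for k
  proof (induction k)
    case 0
    show ?case using less[of 0] by simp
  next
    case (Suc k)
    have "\<forall>\<^sub>F s in sequentially. \<sigma> (Suc k) = extend s k (\<sigma> k)"
      using lim[of k] lim[of "Suc k"] by eventually_elim auto
    then obtain s where "\<sigma> (Suc k) = extend s k (\<sigma> k)"
      using eventually_happens' sequentially_bot by blast
    then have "\<sigma> (Suc k) = \<sigma> k \<or> \<sigma> (Suc k) = \<sigma> k + 2 ^ k"
      by (simp add: extend_def)
    moreover have "nbit (\<sigma> k) k = 0" "nbit (\<sigma> k + 2 ^ k) k = 1"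
      using less[of k] by (simp_all add: nbit_def)
    moreover have "k \<in> Y \<longleftrightarrow> nbit (\<sigma> (Suc k)) k = 1" by (simp add: Y_def)
    ultimately show ?case by (elim disjE) (simp_all add: prefix_code_Suc Suc)
  qed
  then have lim: "\<And>k. \<forall>\<^sub>F s in sequentially. approx s k = prefix_code Y k \<and>
      2 ^ (2 * k) * (\<Sum>i<k. N i s k (prefix_code Y k)) \<le> (2 ^ k - 1) * 2 ^ s"
    using lim by simp
  have "delta02 Y"
  proof (rule delta02_limit)
    show "decidable1 (\<lambda>z. nbit (approx (nsnd z) (Suc (nfst z))) (nfst z) = 1)"
      by (intro computable_intros computable1_nbit computable1_approx)
    show "\<forall>\<^sub>F s in sequentially. (nbit (approx s (Suc x)) x = 1) = (x \<in> Y)" for x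
      using lim[of "Suc x"] by eventually_elim (simp add: nbit_prefix_code del: approx_Suc)
  qed
  moreover have "\<forall>\<^sub>F s in sequentially. 2 ^ s < string_count (V i s) s * 2 ^ (2 * i + 2)"
    if *: "\<exists>\<^sub>F s in sequentially. V i s (prefix_code Y s)" for i
  proof (rule ccontr)
    assume "\<not> ?thesis"
    then have "\<forall>\<^sub>F s in sequentially. B i s = V i s" using large_or_eventually_eq[of i] by blast
    from frequently_ex[OF frequently_eventually_frequently[OF * eventually_conj[OF this
          eventually_mono_B[of i, THEN eventually_all_ge_at_top]]]]
    obtain s where s: "B i s (prefix_code Y s)"
      and mono: "\<forall>s'\<ge>s. \<forall>\<tau><2 ^ Suc s'. B i s' (\<tau> mod 2 ^ s') \<longrightarrow> B i (Suc s') \<tau>"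
      by (elim exE conjE) metis
    have B: "B i s' \<tau>" if "s \<le> s'" "\<tau> < 2 ^ s'" "\<tau> mod 2 ^ s = prefix_code Y s" for s' \<tau>
      using that
    proof (induction s' arbitrary: \<tau> rule: dec_induct)
      case base
      then show ?case using s by simp
    next
      case (step s')
      have "(\<tau> mod 2 ^ s') mod 2 ^ s = \<tau> mod 2 ^ s"
        using step by (simp add: le_imp_power_dvd mod_mod_cancel)
      then have "B i s' (\<tau> mod 2 ^ s')" using step by simp
      then show ?case using mono step by blast
    qed
    \<comment> \<open>Long enough for the cylinder to be contained in \<open>B i\<close>, and for
      the index \<open>i\<close> to be counted in the bound.\<close>
    define k where "k = max s (Suc i)"
    have "\<forall>\<^sub>F s' in sequentially. False"
      using lim[of k] eventually_ge_at_top[of k]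
    proof eventually_elim
      case (elim s')
      have ks: "s \<le> k" "i < k" by (auto simp: k_def)
      have "B i s' \<tau>" if "\<tau> < 2 ^ s'" "\<tau> mod 2 ^ k = prefix_code Y k" for \<tau>
      proof (rule B)
        have "\<tau> mod 2 ^ s = (\<tau> mod 2 ^ k) mod 2 ^ s"
          using ks by (simp add: le_imp_power_dvd mod_mod_cancel)
        then show "\<tau> mod 2 ^ s = prefix_code Y s" using that ks by (simp add: prefix_code_mod)
      qed (use that ks elim in auto)
      then have "string_count (\<lambda>\<tau>. \<tau> mod 2 ^ k = prefix_code Y k) s' \<le> N i s' k (prefix_code Y k)"
        unfolding N_def by (intro string_count_mono) auto
      also have "\<dots> \<le> (\<Sum>i<k. N i s' k (prefix_code Y k))"
        using ks by (intro member_le_sum) auto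
      finally have "2 ^ (s' - k) * string_count (\<lambda>\<tau>. \<tau> = prefix_code Y k) k \<le> (\<Sum>i<k. N i s' k (prefix_code Y k))"
        using string_count_mod[of k s' "\<lambda>\<tau>. \<tau> = prefix_code Y k"] elim by simp
      moreover have "string_count (\<lambda>\<tau>. \<tau> = prefix_code Y k) k = 1"
        using prefix_code_less[of Y k] by (simp add: string_count_def of_bool_def)
      ultimately have "2 ^ (2 * k) * 2 ^ (s' - k) \<le> 2 ^ (2 * k) * (\<Sum>i<k. N i s' k (prefix_code Y k))"
        by simp
      also have "\<dots> \<le> (2 ^ k - 1) * 2 ^ s'" using elim by simp
      also have "\<dots> < 2 ^ k * 2 ^ s'" by simp
      also have "\<dots> = 2 ^ (2 * k) * 2 ^ (s' - k)" using elim by (simp flip: power_add)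
      finally show False by simp
    qed
    then show False by simp
  qed
  ultimately show ?thesis by blast
qed

end


section \<open>The use principle\<close>

lemma justified_oracle_mono:
  assumes "justified Q D v"
    and "Q (nnth (nfst (nsnd v)) 0) (nsnd (nsnd v)) \<Longrightarrow> Q' (nnth (nfst (nsnd v)) 0) (nsnd (nsnd v))"
  shows "justified Q' D v"
  using assms(1) unfolding justified_def
  by (elim disj_forward) (assumption | (elim conj_forward, assumption+, erule assms(2)))+

lemma derivation_oracle_mono:
  assumes "derivation Q ds"
    and "\<And>v. v \<in> set ds \<Longrightarrow> Q (nnth (nfst (nsnd v)) 0) (nsnd (nsnd v)) \<Longrightarrow>
      Q' (nnth (nfst (nsnd v)) 0) (nsnd (nsnd v))"
  shows "derivation Q' ds"
  using assms by (induction ds) (auto elim: justified_oracle_mono)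

text \<open>A derivation accepted at \<open>s\<close> queries only positions below \<open>s\<close>,
  where the two strings agree.\<close>

lemma steps_mono:
  assumes "steps s \<tau> p xs y" "s \<le> s'" "\<tau>' mod 2 ^ s = \<tau> mod 2 ^ s"
  shows "steps s' \<tau>' p xs y"
proof -
  obtain d where d: "d < s" "derivation (\<lambda>x b. x < s \<and> b = nbit \<tau> x) (list_decode d)"
      "entry p xs y \<in> set (list_decode d)"
    using assms(1) unfolding steps_def by blast
  have "derivation (\<lambda>x b. x < s' \<and> b = nbit \<tau>' x) (list_decode d)"
    using d(2) by (rule derivation_oracle_mono) (use assms nbit_cong[OF assms(3)] in auto)
  then show ?thesis unfolding steps_def using d assms(2) by (meson less_le_trans)
qed

lemma steps_sound:
  assumes "steps s \<tau> (code p) (list_encode xs) y" "\<tau> mod 2 ^ s = prefix_code X s"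
  shows "eval X p xs y"
proof -
  obtain d where d: "derivation (\<lambda>x b. x < s \<and> b = nbit \<tau> x) (list_decode d)"
      "entry (code p) (list_encode xs) y \<in> set (list_decode d)"
    using assms(1) unfolding steps_def by blast
  show ?thesis
  proof (rule derivation_sound[OF d])
    fix x b assume "x < s \<and> b = nbit \<tau> x"
    then show "b = of_bool (x \<in> X)"
      using nbit_mod[of x s \<tau>] nbit_prefix_code[of x s X] assms(2) by metis
  qed
qed

text \<open>A derivation is finite, so almost every \<open>s\<close> exceeds all of its queries and
  its code.\<close>

lemma eventually_steps:
  assumes "eval X p xs y"
  shows "\<forall>\<^sub>F s in sequentially. steps s (prefix_code X s) (code p) (list_encode xs) y"
proof -
  obtain ds where ds: "derivation (\<lambda>x b. b = of_bool (x \<in> X)) ds" "entry (code p) (list_encode xs) y \<in> set ds"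
    using eval_derivable[OF assms] unfolding derivable_def by blast
  have "\<forall>\<^sub>F s in sequentially. \<forall>v\<in>set ds. nnth (nfst (nsnd v)) 0 < s"
    by (intro eventually_ball_finite ballI eventually_gt_at_top) simp
  then show ?thesis using eventually_gt_at_top[of "list_encode ds"]
  proof eventually_elim
    case (elim s)
    have "derivation (\<lambda>x b. x < s \<and> b = nbit (prefix_code X s) x) ds"
      using ds(1) by (rule derivation_oracle_mono) (use elim in \<open>auto simp: nbit_prefix_code\<close>)
    then show ?case unfolding steps_def using ds(2) elim by (intro exI[of _ "list_encode ds"]) simp
  qed
qed

text \<open>The string 0 is a prefix of the empty oracle, and bounding the value keeps the predicate
  decidable.\<close>

definition halted :: "nat \<Rightarrow> nat \<Rightarrow> nat \<Rightarrow> bool" where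
  "halted s p xs \<longleftrightarrow> (\<exists>y<s. steps s 0 p xs y)"

lemma halted_mono: "halted s p xs \<Longrightarrow> s \<le> t \<Longrightarrow> halted t p xs"
  unfolding halted_def using steps_mono[of s 0 p xs _ t 0] by (auto intro: less_le_trans)

lemma prefix_code_empty: "prefix_code {} s = 0"
  by (simp add: prefix_code_def)

lemma halted_iff_eval: "(\<exists>s. halted s (code p) (list_encode xs)) \<longleftrightarrow> (\<exists>y. eval {} p xs y)"
proof
  assume "\<exists>y. eval {} p xs y"
  then obtain y where "eval {} p xs y" by blast
  from eventually_conj[OF eventually_steps[OF this] eventually_gt_at_top[of y]]
  show "\<exists>s. halted s (code p) (list_encode xs)"
    unfolding halted_def prefix_code_empty eventually_sequentially by blast
qed (auto simp: halted_def prefix_code_empty dest!: steps_sound[where X = "{}"])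

lemma eventually_eq_limit:
  assumes "\<And>s t :: nat. s \<le> t \<Longrightarrow> P s \<Longrightarrow> P t"
  shows "\<forall>\<^sub>F s in sequentially. P s \<longleftrightarrow> (\<exists>t. P t)"
proof (cases "\<exists>t. P t")
  case True
  then show ?thesis using assms unfolding eventually_sequentially by metis
qed simp

lemma eventually_halted_iff:
  "\<forall>\<^sub>F s in sequentially. halted s (code p) (list_encode xs) \<longleftrightarrow> (\<exists>y. eval {} p xs y)"
  unfolding halted_iff_eval[symmetric] by (rule eventually_eq_limit) (rule halted_mono)

lemma decidable1_halted:
  assumes "computable1 s" "computable1 p" "computable1 xs"
  shows "decidable1 (\<lambda>x. halted (s x) (p x) (xs x))"
proof -
  have "decidable1 (\<lambda>z. halted (nfst z) (nfst (nsnd z)) (nsnd (nsnd z)))"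
    unfolding halted_def by (intro computable_intros decidable1_steps)
  from decidable_compose3[OF this assms] show ?thesis .
qed


section \<open>The measure of a set of strings\<close>

definition region :: "(nat \<Rightarrow> bool) \<Rightarrow> nat \<Rightarrow> (nat \<Rightarrow> bool) set" where
  "region P s = {f. P (prefix_code {i. f i} s)}"

lemma measure_cylinder:
  "cylinder \<sigma> \<in> sets coin_measure" "measure coin_measure (cylinder \<sigma>) = (1/2) ^ length \<sigma>"
proof -
  let ?M = "\<lambda>_::nat. measure_pmf (bernoulli_pmf (1/2))"
  interpret product_prob_space ?M UNIV by unfold_locales
  have eq: "cylinder \<sigma> = prod_emb UNIV ?M {..<length \<sigma>} (PiE {..<length \<sigma>} (\<lambda>i. {\<sigma> ! i}))"
    by (auto simp: cylinder_def prod_emb_def PiE_def Pi_def extensional_def restrict_def)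
  show "cylinder \<sigma> \<in> sets coin_measure"
    unfolding eq coin_measure_def by (rule sets_PiM_I) auto
  have half: "measure (measure_pmf (bernoulli_pmf (1/2))) {b} = 1/2" for b
    by (cases b) (simp_all add: measure_pmf_single)
  then show "measure coin_measure (cylinder \<sigma>) = (1/2) ^ length \<sigma>"
    unfolding eq coin_measure_def by (subst measure_PiM_emb) (auto simp: half)
qed

interpretation coin: prob_space coin_measure
  unfolding coin_measure_def by (intro prob_space_PiM measure_pmf.prob_space_axioms)

lemma prefix_code_eq_iff:
  "prefix_code X s = \<tau> mod 2 ^ s \<longleftrightarrow> (\<forall>i<s. of_bool (i \<in> X) = nbit \<tau> i)"
proof
  assume "prefix_code X s = \<tau> mod 2 ^ s"
  then show "\<forall>i<s. of_bool (i \<in> X) = nbit \<tau> i" by (metis nbit_mod nbit_prefix_code)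
next
  assume *: "\<forall>i<s. of_bool (i \<in> X) = nbit \<tau> i"
  have "prefix_code X k = \<tau> mod 2 ^ k" if "k \<le> s" for k
    using that
  proof (induction k)
    case (Suc k)
    then show ?case using *[rule_format, of k] unfolding mod_power_Suc prefix_code_Suc by simp
  qed simp
  then show "prefix_code X s = \<tau> mod 2 ^ s" by simp
qed

lemma region_eq: "region (\<lambda>\<rho>. \<rho> = \<tau>) s = cylinder (map (\<lambda>i. nbit \<tau> i = 1) [0..<s])" if "\<tau> < 2 ^ s"
proof -
  have "prefix_code X s = \<tau> \<longleftrightarrow> (\<forall>i<s. of_bool (i \<in> X) = nbit \<tau> i)" for X
    using prefix_code_eq_iff[of X s \<tau>] that by simp
  moreover have "of_bool b = nbit \<tau> i \<longleftrightarrow> b = (nbit \<tau> i = 1)" for b i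
    using nbit_less_2[of \<tau> i] by (cases b) auto
  ultimately show ?thesis by (simp add: region_def cylinder_def)
qed

lemma measure_region:
  "region P s \<in> sets coin_measure" "measure coin_measure (region P s) = string_count P s / 2 ^ s"
proof -
  let ?C = "\<lambda>\<tau>. region (\<lambda>\<rho>. \<rho> = \<tau>) s"
  let ?T = "{\<tau>. \<tau> < 2 ^ s \<and> P \<tau>}"
  have eq: "region P s = (\<Union>\<tau>\<in>?T. ?C \<tau>)"
    by (auto simp: region_def prefix_code_less)
  have C: "?C \<tau> \<in> sets coin_measure" "measure coin_measure (?C \<tau>) = (1/2) ^ s" if "\<tau> \<in> ?T" for \<tau>
    using that by (simp_all add: region_eq measure_cylinder)
  show "region P s \<in> sets coin_measure"
    unfolding eq by (intro sets.finite_UN C) auto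
  have "measure coin_measure (region P s) = (\<Sum>\<tau>\<in>?T. measure coin_measure (?C \<tau>))"
    unfolding eq using C(1)
    by (intro coin.finite_measure_finite_Union) (auto simp: disjoint_family_on_def region_def)
  also have "\<dots> = card ?T * (1/2) ^ s" using C(2) by simp
  finally show "measure coin_measure (region P s) = string_count P s / 2 ^ s"
    by (simp add: string_count_eq_card power_divide)
qed

lemma uniformly_ce_open_sets:
  assumes "uniformly_ce_open G" shows "G n \<in> sets coin_measure"
  using assms unfolding uniformly_ce_open_def
  by (metis (no_types, lifting) countableI_type measure_cylinder(1) sets.countable_UN'')


section \<open>The requirements\<close>

lemma ncons_0 [simp]: "ncons x 0 = list_encode [x]"
  by (simp add: ncons_def npair_def list_encode.simps(2))

text \<open>Stage \<open>s\<close> of the union of the test sets with index at least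
  \<open>k\<close>: the string with code \<open>u\<close> is enumerated into one of them and is a
  prefix of \<open>\<tau>\<close>. Lists with entries other than 0 and 1 never match
  \<open>nbit\<close>.\<close>

definition ml_stage :: "nat \<Rightarrow> nat \<Rightarrow> nat \<Rightarrow> nat \<Rightarrow> bool" where
  "ml_stage p k s \<tau> \<longleftrightarrow> (\<exists>m<s. k \<le> m \<and> (\<exists>u<s. halted s p (ncons m (ncons u 0)) \<and>
    nlength u \<le> s \<and> (\<forall>l<nlength u. nnth u l = nbit \<tau> l)))"

lemma ml_stage_mono:
  assumes "ml_stage p k s (\<tau> mod 2 ^ s)" "s \<le> t" shows "ml_stage p k t \<tau>"
proof -
  obtain m u where "m < s" "k \<le> m" "u < s" "halted s p (ncons m (ncons u 0))" "nlength u \<le> s"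
      "\<forall>l<nlength u. nnth u l = nbit (\<tau> mod 2 ^ s) l"
    using assms(1) unfolding ml_stage_def by blast
  moreover from this have "\<forall>l<nlength u. nnth u l = nbit \<tau> l" by (simp add: nbit_mod)
  ultimately show ?thesis
    using assms(2) halted_mono[OF _ assms(2)] unfolding ml_stage_def by (meson less_le_trans order_trans)
qed

lemma ml_stage_region:
  assumes G: "\<And>n. G n = (\<Union>\<sigma> \<in> {\<sigma>. \<exists>y. eval {} p [n, string_code \<sigma>] y}. cylinder \<sigma>)"
    and f: "f \<in> region (ml_stage (code p) k s) s"
  shows "\<exists>m. k \<le> m \<and> m < s \<and> f \<in> G m"
proof -
  obtain m u where m: "m < s" "k \<le> m" and halt: "halted s (code p) (list_encode [m, u])"
    and u: "nlength u \<le> s" "\<forall>l<nlength u. nnth u l = nbit (prefix_code {i. f i} s) l"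
    using f unfolding ml_stage_def region_def by auto
  define \<sigma> where "\<sigma> = map f [0..<nlength u]"
  have "u = list_encode (map of_bool \<sigma>)"
  proof -
    obtain us where us: "u = list_encode us" by (metis list_decode_inverse)
    have "us ! l = of_bool (f l)" if "l < length us" for l
      using u that unfolding us by (simp add: nbit_prefix_code)
    then show ?thesis unfolding us \<sigma>_def by (intro arg_cong[of _ _ list_encode] nth_equalityI) auto
  qed
  then have "\<exists>y. eval {} p [m, string_code \<sigma>] y"
    using halt by (auto simp: string_code_def halted_iff_eval[symmetric])
  moreover have "f \<in> cylinder \<sigma>" by (simp add: cylinder_def \<sigma>_def)
  ultimately show ?thesis using m G by blast
qed

lemma region_ml_stage:
  assumes "f \<in> cylinder \<sigma>" "eval {} p [m, string_code \<sigma>] y" "k \<le> m"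
  shows "\<forall>\<^sub>F s in sequentially. ml_stage (code p) k s (prefix_code {i. f i} s)"
proof -
  have "\<forall>\<^sub>F s in sequentially. halted s (code p) (list_encode [m, string_code \<sigma>])"
    using eventually_halted_iff[of p "[m, string_code \<sigma>]"] assms(2) by (auto elim: eventually_mono)
  then show ?thesis
    using eventually_gt_at_top[of m] eventually_gt_at_top[of "string_code \<sigma>"] eventually_ge_at_top[of "length \<sigma>"]
  proof eventually_elim
    case (elim s)
    have "nnth (string_code \<sigma>) l = nbit (prefix_code {i. f i} s) l" if "l < length \<sigma>" for l
      using that elim assms(1) by (simp add: string_code_def nbit_prefix_code cylinder_def)
    moreover have "nlength (string_code \<sigma>) = length \<sigma>" by (simp add: string_code_def)
    moreover have "halted s (code p) (ncons m (ncons (string_code \<sigma>) 0))" using elim by simp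
    ultimately show ?case unfolding ml_stage_def using elim assms(3) by metis
  qed
qed

lemma sum_half_powers: "(\<Sum>m\<in>{k..<s}. (1/2) ^ m) \<le> 2 * (1/2 :: real) ^ k"
proof (cases "k \<le> s")
  case True
  then have "(\<Sum>m\<in>{k..<s}. (1/2) ^ m) = 2 * (1/2) ^ k - 2 * (1/2 :: real) ^ s"
    by (induction s rule: dec_induct) auto
  then show ?thesis by simp
qed simp

text \<open>By the geometric series, the test sets from index \<open>Suc k\<close> on have measures
  adding up to at most \<open>2\<close> to the power \<open>- k\<close>.\<close>

lemma ml_stage_small:
  assumes test: "martin_loef_test G"
    and G: "\<And>n. G n = (\<Union>\<sigma> \<in> {\<sigma>. \<exists>y. eval {} p [n, string_code \<sigma>] y}. cylinder \<sigma>)"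
  shows "string_count (ml_stage (code p) (Suc k) s) s * 2 ^ k \<le> 2 ^ s"
proof -
  have sets: "G m \<in> sets coin_measure" for m
    using test uniformly_ce_open_sets by (simp add: martin_loef_test_def)
  have "region (ml_stage (code p) (Suc k) s) s \<subseteq> (\<Union>m\<in>{Suc k..<s}. G m)"
    using ml_stage_region[OF G] by fastforce
  then have "measure coin_measure (region (ml_stage (code p) (Suc k) s) s) \<le> measure coin_measure (\<Union>m\<in>{Suc k..<s}. G m)"
    using sets by (intro coin.finite_measure_mono) auto
  also have "\<dots> \<le> (\<Sum>m\<in>{Suc k..<s}. measure coin_measure (G m))"
    using sets by (intro coin.finite_measure_subadditive_finite) auto
  also have "\<dots> \<le> (\<Sum>m\<in>{Suc k..<s}. (1/2) ^ m)"
    using test by (intro sum_mono) (simp add: martin_loef_test_def)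
  also have "\<dots> \<le> (1/2) ^ k" using sum_half_powers[of "Suc k" s] by simp
  finally have "real (string_count (ml_stage (code p) (Suc k) s) s * 2 ^ k) \<le> real (2 ^ s)"
    by (simp add: measure_region field_simps)
  then show ?thesis unfolding of_nat_le_iff .
qed

section \<open>Requirements for a cost function\<close>

locale cost =
  fixes c :: "nat \<Rightarrow> nat \<Rightarrow> rat" and num den :: "nat \<Rightarrow> nat \<Rightarrow> nat"
  assumes num: "computable2 num" and den: "computable2 den"
    and den_pos: "\<And>x s. den x s > 0"
    and c_eq: "\<And>x s. c x s = of_nat (num x s) / of_nat (den x s)"
    and limit: "limit_condition c"
begin

text \<open>
  At level \<open>n\<close> of the requirement \<open>j\<close> a number is costly if its cost exceeds \<open>2\<close> to the power
  \<open>- threshold j n\<close>. Level \<open>Suc n\<close> incurs at most \<open>2 ^ (2 * npair j (Suc n) + 2)\<close> charges for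
  numbers that are not costly at level \<open>n\<close>, contributing at most \<open>2\<close> to the power \<open>- n\<close>.
\<close>

definition threshold :: "nat \<Rightarrow> nat \<Rightarrow> nat" where
  "threshold j n = 2 * npair j (Suc n) + 2 + n"

text \<open>All stages up to \<open>s\<close> are searched because \<open>c\<close> need not be
  monotone in the stage; thus a costly number stays costly.\<close>

definition costly :: "nat \<Rightarrow> nat \<Rightarrow> nat \<Rightarrow> nat \<Rightarrow> bool" where
  "costly s j n x \<longleftrightarrow> (\<exists>t<Suc s. den x t < num x t * 2 ^ threshold j n)"

text \<open>The bound \<open>x < s\<close> makes the quantifier decidable and eventually covers all
  costly numbers, by \<open>finite_costly\<close>.\<close>

definition functional_stage :: "nat \<Rightarrow> nat \<Rightarrow> nat \<Rightarrow> nat \<Rightarrow> nat \<Rightarrow> nat \<Rightarrow> bool" where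
  "functional_stage p q j n s \<tau> \<longleftrightarrow>
    (\<forall>x<s. costly s j n x \<longrightarrow> steps s \<tau> p (ncons x 0) (of_bool (halted s q (ncons x 0))))"

text \<open>The index \<open>i\<close> pairs a requirement with a level. Tag 0 stands for a
  Martin-Loef test, any other tag for a functional together with an enumeration. Starting at
  \<open>2 * i + 3\<close> gives the tail of an actual test measure at most \<open>2\<close> to the
  power \<open>- (2 * i + 2)\<close>, so it has to be avoided.\<close>

definition V :: "nat \<Rightarrow> nat \<Rightarrow> nat \<Rightarrow> bool" where
  "V i s \<tau> \<longleftrightarrow>
    (nfst (nfst i) = 0 \<longrightarrow> ml_stage (nsnd (nfst i)) (2 * i + 3) s \<tau>) \<and>
    (nfst (nfst i) \<noteq> 0 \<longrightarrow>
      functional_stage (nfst (nsnd (nfst i))) (nsnd (nsnd (nfst i))) (nfst i) (nsnd i) s \<tau>)"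

lemma costly_mono: "costly s j n x \<Longrightarrow> s \<le> t \<Longrightarrow> costly t j n x"
  unfolding costly_def by (meson Suc_le_mono less_le_trans)

lemma less_cost_iff: "(1/2) ^ k < real_of_rat (c x t) \<longleftrightarrow> den x t < num x t * 2 ^ k"
proof -
  have "(1/2) ^ k < real_of_rat (c x t) \<longleftrightarrow> real (den x t) < real (num x t * 2 ^ k)"
    using den_pos[of x t] by (simp add: c_eq of_rat_divide field_simps)
  then show ?thesis unfolding of_nat_less_iff .
qed

text \<open>By the limit condition the suprema of the costs fall below the threshold for all large
  \<open>x\<close>. Convergence bounds each range, so each supremum is above all its terms.\<close>

lemma finite_costly: "finite {x. \<exists>s. costly s j n x}"
proof -
  let ?sup = "\<lambda>x. SUP s. real_of_rat (c x s)"
  have "\<forall>\<^sub>F x in sequentially. ?sup x < (1/2) ^ threshold j n"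
    using limit by (intro order_tendstoD(2)[of _ 0]) (auto simp: limit_condition_def)
  then obtain N where N: "\<And>x. N \<le> x \<Longrightarrow> ?sup x < (1/2) ^ threshold j n"
    unfolding eventually_sequentially by blast
  have "real_of_rat (c x s) \<le> ?sup x" for x s
  proof (rule cSUP_upper)
    have "convergent (\<lambda>s. real_of_rat (c x s))" using limit by (simp add: limit_condition_def)
    then have "Bseq (\<lambda>s. real_of_rat (c x s))" by (rule convergent_imp_Bseq)
    then show "bdd_above (range (\<lambda>s. real_of_rat (c x s)))"
      by (simp add: Bseq_eq_bounded bounded_imp_bdd_above)
  qed simp
  then have "\<not> (1/2) ^ threshold j n < real_of_rat (c x s)" if "N \<le> x" for x s
    using N[OF that] by (meson le_less_trans less_asym')
  then have "\<not> costly s j n x" if "N \<le> x" for x s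
    using that unfolding costly_def less_cost_iff by blast
  then have "{x. \<exists>s. costly s j n x} \<subseteq> {..<N}"
    by (auto simp: not_le[symmetric])
  then show ?thesis using finite_subset by blast
qed

text \<open>Only finitely many numbers are ever costly. Once these have been found and the
  enumeration has settled on them, later stages only add computations.\<close>

lemma eventually_functional_stage_mono:
  "\<forall>\<^sub>F s in sequentially. \<forall>\<tau><2 ^ Suc s.
    functional_stage p q j n s (\<tau> mod 2 ^ s) \<longrightarrow> functional_stage p q j n (Suc s) \<tau>"
proof -
  let ?F = "{x. \<exists>s. costly s j n x}"
  have "\<forall>\<^sub>F s in sequentially. \<forall>x\<in>?F. x < s \<and> (costly s j n x \<longleftrightarrow> (\<exists>t. costly t j n x)) \<and>
      (halted s q (ncons x 0) \<longleftrightarrow> (\<exists>t. halted t q (ncons x 0)))"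
    by (intro eventually_ball_finite finite_costly ballI eventually_conj eventually_gt_at_top eventually_eq_limit)
      (auto intro: costly_mono halted_mono)
  note this eventually_sequentially_Suc[THEN iffD2, OF this]
  then show ?thesis
  proof eventually_elim
    case (elim s)
    show ?case
    proof (intro allI impI)
      fix \<tau> :: nat
      assume *: "functional_stage p q j n s (\<tau> mod 2 ^ s)"
      show "functional_stage p q j n (Suc s) \<tau>"
        unfolding functional_stage_def
      proof (intro allI impI)
        fix x assume "costly (Suc s) j n x"
        then have x: "x < s" "costly s j n x" "halted (Suc s) q (ncons x 0) \<longleftrightarrow> halted s q (ncons x 0)"
          using elim by blast+
        then have "steps s (\<tau> mod 2 ^ s) p (ncons x 0) (of_bool (halted s q (ncons x 0)))"
          using * by (simp add: functional_stage_def)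
        then show "steps (Suc s) \<tau> p (ncons x 0) (of_bool (halted (Suc s) q (ncons x 0)))"
          unfolding x(3) by (rule steps_mono) auto
      qed
    qed
  qed
qed

sublocale avoidance V
proof
  have costly: "decidable1 (\<lambda>z. costly (nfst z) (nfst (nsnd z)) (nfst (nsnd (nsnd z))) (nsnd (nsnd (nsnd z))))"
    unfolding costly_def threshold_def
    by (intro computable_intros computable2_comp[OF num] computable2_comp[OF den])
  show "decidable1 (\<lambda>z. V (nfst z) (nfst (nsnd z)) (nsnd (nsnd z)))"
    unfolding V_def ml_stage_def functional_stage_def
    by (intro computable_intros computable1_nlength computable1_nnth computable1_ncons computable1_nbit
        decidable1_steps decidable1_halted decidable_compose4[where P = costly, OF costly])
  show "\<forall>\<^sub>F s in sequentially. \<forall>\<tau><2 ^ Suc s. V i s (\<tau> mod 2 ^ s) \<longrightarrow> V i (Suc s) \<tau>" for i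
  proof (cases "nfst (nfst i) = 0")
    case True
    then show ?thesis
      by (intro always_eventually allI impI) (auto simp: V_def elim: ml_stage_mono)
  next
    case False
    then show ?thesis using eventually_functional_stage_mono by (simp add: V_def)
  qed
qed

text \<open>Stage \<open>t\<close> shows that \<open>V i t\<close> is too large to be
  avoided.\<close>

definition certified :: "nat \<Rightarrow> nat \<Rightarrow> bool" where
  "certified i t \<longleftrightarrow> 2 ^ t < string_count (V i t) t * 2 ^ (2 * i + 2)"

text \<open>The tail of an actual test is too small to be certified, so \<open>Y\<close> is not in
  \<open>V i\<close> infinitely often. But membership of \<open>Y\<close> in a late test set would
  put almost all of its prefixes into \<open>V i\<close>.\<close>

lemma one_random_if_avoiding:
  assumes "\<And>i. \<exists>\<^sub>F s in sequentially. V i s (prefix_code Y s) \<Longrightarrow> \<forall>\<^sub>F s in sequentially. certified i s"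
  shows "one_random Y"
  unfolding one_random_def
proof (intro allI impI)
  fix G assume test: "martin_loef_test G"
  then obtain p where G: "\<And>n. G n = (\<Union>\<sigma> \<in> {\<sigma>. \<exists>y. eval {} p [n, string_code \<sigma>] y}. cylinder \<sigma>)"
    unfolding martin_loef_test_def uniformly_ce_open_def by blast
  define i where "i = npair (npair 0 (code p)) 0"
  have V: "V i s = ml_stage (code p) (Suc (2 * i + 2)) s" for s
    by (simp add: V_def fun_eq_iff i_def numeral_3_eq_3)
  have "\<not> certified i s" for s
    unfolding certified_def V not_less by (rule ml_stage_small[OF test G])
  then have not_V: "\<not> (\<exists>\<^sub>F s in sequentially. V i s (prefix_code Y s))"
    using assms[of i] by auto
  have "(\<lambda>i. i \<in> Y) \<notin> G m" if "2 * i + 3 \<le> m" for m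
  proof
    assume "(\<lambda>i. i \<in> Y) \<in> G m"
    then obtain \<sigma> y where "(\<lambda>i. i \<in> Y) \<in> cylinder \<sigma>" "eval {} p [m, string_code \<sigma>] y"
      unfolding G by blast
    from region_ml_stage[OF this, of "Suc (2 * i + 2)"] that
    have "\<forall>\<^sub>F s in sequentially. V i s (prefix_code Y s)" by (simp add: V)
    then show False using not_V eventually_frequently[OF sequentially_bot] by blast
  qed
  then show "\<forall>\<^sub>F n in sequentially. (\<lambda>i. i \<in> Y) \<notin> G n"
    unfolding eventually_sequentially by blast
qed

end

text \<open>
  The approximation enumerates \<open>A\<close> only at stages \<open>t s\<close> at which, for each level \<open>n \<le> s\<close>, a large
  set of oracles computes \<open>A\<close> correctly on the costly numbers. When such a number later enters
  \<open>A\<close>, all these oracles are refuted for good, so the sets belonging to different charges at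
  level \<open>n\<close> are disjoint.
\<close>

locale certified_reduction = cost +
  fixes p q :: recf and A :: "nat set"
  assumes ce: "\<And>x. x \<in> A \<longleftrightarrow> (\<exists>y. eval {} q [x] y)"
    and certified: "\<And>n. \<forall>\<^sub>F t in sequentially. certified (npair (npair 1 (npair (code p) (code q))) n) t"
begin

section \<open>Enumeration at certified stages\<close>

definition j :: nat where "j = npair 1 (npair (code p) (code q))"

definition t :: "nat \<Rightarrow> nat" where
  "t s = (LEAST u. s < u \<and> (\<forall>n<Suc s. certified (npair j n) u))"

definition As :: "nat \<Rightarrow> nat set" where
  "As s = {x. halted (t s) (code q) (ncons x 0)}"

lemma V_iff: "V (npair j n) s \<tau> \<longleftrightarrow> functional_stage (code p) (code q) j n s \<tau>"
  by (simp add: V_def j_def)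

lemma ex_certified: "\<exists>u. s < u \<and> (\<forall>n<Suc s. certified (npair j n) u)"
proof -
  have "\<forall>\<^sub>F u in sequentially. s < u \<and> (\<forall>n\<in>{..<Suc s}. certified (npair j n) u)"
    using certified by (intro eventually_conj eventually_gt_at_top eventually_ball_finite) (auto simp: j_def)
  then show ?thesis using eventually_happens' sequentially_bot by fastforce
qed

lemma t_gt: "s < t s" and t_certified: "n \<le> s \<Longrightarrow> certified (npair j n) (t s)"
  using LeastI_ex[OF ex_certified[of s]] unfolding t_def by auto

text \<open>The conditions on \<open>t s'\<close> include those on \<open>t s\<close>.\<close>

lemma t_mono: "s \<le> s' \<Longrightarrow> t s \<le> t s'"
  unfolding t_def[of s] by (rule Least_le) (use t_gt[of s'] t_certified[of _ s'] in auto)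

lemma As_mono: "s \<le> s' \<Longrightarrow> As s \<subseteq> As s'"
  using halted_mono[OF _ t_mono] by (auto simp: As_def)

lemma computable_approximation_As: "computable_approximation As A"
  unfolding computable_approximation_def
proof
  note V = decidable_compose3[where P = V, OF decidable_V]
  have "decidable1 (\<lambda>z. certified (nfst z) (nsnd z))"
    unfolding certified_def string_count_def by (intro computable_intros V)
  note certified = computable_compose2[where F = "\<lambda>x y. of_bool (certified x y)", folded decidable1_def, OF this]
  have "computable1 t"
    unfolding t_def[abs_def] by (intro computable1_Least ex_certified computable_intros certified)
  note t = computable1_comp[OF this]
  show "computable2 (\<lambda>s n. of_bool (n \<in> As s))"
    unfolding As_def mem_Collect_eq
    by (intro computable2I computable_intros decidable1_halted computable1_ncons t)
  show "\<forall>n. \<forall>\<^sub>F s in sequentially. (n \<in> As s) = (n \<in> A)"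
  proof
    fix n
    have "filterlim t sequentially sequentially"
      using t_gt by (intro filterlim_at_top_mono[OF filterlim_ident]) (auto intro!: always_eventually less_imp_le)
    from eventually_compose_filterlim[OF eventually_halted_iff[of q "[n]"] this]
    show "\<forall>\<^sub>F s in sequentially. (n \<in> As s) = (n \<in> A)" by (simp add: As_def ce)
  qed
qed

section \<open>Charges and the oracles they refute\<close>

definition charged :: "nat \<Rightarrow> bool" where
  "charged s \<longleftrightarrow> s > 0 \<and> (\<exists>x. changes_at As s x)"

definition X :: "nat \<Rightarrow> nat" where
  "X s = (LEAST x. changes_at As s x)"

text \<open>The condition \<open>n < s\<close> ensures that level \<open>n\<close> was certified at
  the stage \<open>t (s - 1)\<close>, the last one before the change.\<close>

definition level :: "nat \<Rightarrow> nat set" where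
  "level n = {s. charged s \<and> n < s \<and> (1/2) ^ threshold j n < real_of_rat (c (X s) s)}"

lemma X: "X s < s" "X s \<notin> As (s - 1)" "X s \<in> As s" if "charged s"
proof -
  have "changes_at As s (X s)" using that unfolding charged_def X_def by (auto intro: LeastI)
  then show "X s < s" "X s \<notin> As (s - 1)" "X s \<in> As s"
    using As_mono[of "s - 1" s] by (auto simp: changes_at_def)
qed

text \<open>The oracles counted in the certificate used just before the change at \<open>s\<close>;
  a costly change refutes them.\<close>

definition oracles :: "nat \<Rightarrow> nat \<Rightarrow> (nat \<Rightarrow> bool) set" where
  "oracles n s = region (V (npair j n) (t (s - 1))) (t (s - 1))"

lemma sets_oracles: "oracles n s \<in> sets coin_measure"
  by (simp add: oracles_def measure_region)

lemma measure_oracles: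
  assumes "s \<in> level n"
  shows "(1/2) ^ (2 * npair j n + 2) \<le> measure coin_measure (oracles n s)"
proof -
  let ?u = "t (s - 1)"
  have "certified (npair j n) ?u" using assms by (intro t_certified) (auto simp: level_def)
  then have "real (2 ^ ?u) < real (string_count (V (npair j n) ?u) ?u * 2 ^ (2 * npair j n + 2))"
    unfolding certified_def of_nat_less_iff .
  then show ?thesis by (simp add: oracles_def measure_region field_simps)
qed

text \<open>Since \<open>s \<le> s' \<le> t (s' - 1)\<close>, the number \<open>X s\<close> is
  already found costly at that stage, so the oracles must be correct on it as of
  \<open>s' - 1\<close>.\<close>

lemma oracles_eval:
  assumes "f \<in> oracles n s'" "s \<le> s'" "s \<in> level n"
  shows "eval {i. f i} p [X s] (of_bool (X s \<in> As (s' - 1)))"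
proof -
  let ?u = "t (s' - 1)"
  have s: "charged s" "(1/2) ^ threshold j n < real_of_rat (c (X s) s)"
    using assms(3) by (auto simp: level_def)
  have su: "s \<le> ?u" using t_gt[of "s' - 1"] assms(2) by simp
  then have "X s < ?u" using X(1)[OF s(1)] by simp
  moreover have "costly ?u j n (X s)"
    using s(2) su unfolding costly_def less_cost_iff by (intro exI[of _ s]) simp
  moreover have "functional_stage (code p) (code q) j n ?u (prefix_code {i. f i} ?u)"
    using assms(1) by (simp add: oracles_def region_def V_iff)
  ultimately have "steps ?u (prefix_code {i. f i} ?u) (code p) (list_encode [X s]) (of_bool (X s \<in> As (s' - 1)))"
    unfolding functional_stage_def As_def by simp
  then show ?thesis by (rule steps_sound) (simp add: prefix_code_less)
qed

text \<open>For \<open>s < s'\<close>, an oracle in both sets would give on \<open>X s\<close> the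
  value 0, as of \<open>s - 1\<close>, and the value 1, as of \<open>s' - 1\<close>.\<close>

lemma disjoint_oracles: "disjoint_family_on (oracles n) (level n)"
proof -
  have "oracles n s \<inter> oracles n s' = {}" if "s \<in> level n" "s < s'" for s s'
  proof (rule ccontr)
    assume "oracles n s \<inter> oracles n s' \<noteq> {}"
    then obtain f where "f \<in> oracles n s" "f \<in> oracles n s'" by blast
    then have "eval {i. f i} p [X s] (of_bool (X s \<in> As (s - 1)))"
        "eval {i. f i} p [X s] (of_bool (X s \<in> As (s' - 1)))"
      using that oracles_eval by (auto simp del: of_bool_eq_iff)
    then have "(of_bool (X s \<in> As (s - 1)) :: nat) = of_bool (X s \<in> As (s' - 1))"
      by (rule eval_deterministic)
    moreover have "As s \<subseteq> As (s' - 1)" using that(2) by (intro As_mono) simp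
    then have "X s \<notin> As (s - 1)" "X s \<in> As (s' - 1)"
      using that(1) X[of s] by (auto simp: level_def)
    ultimately show False by simp
  qed
  then show ?thesis unfolding disjoint_family_on_def by (metis Int_commute linorder_neqE_nat)
qed

lemma card_level:
  "finite (level n)" "card (level n) \<le> 2 ^ (2 * npair j n + 2)"
proof -
  \<comment> \<open>Disjoint sets of measure at least \<open>2\<close> to the power
    \<open>- (2 * npair j n + 2)\<close> fit into a probability space only that often. Bounding
    finite subsets first also yields finiteness of the level.\<close>
  have bound: "card F \<le> 2 ^ (2 * npair j n + 2)" if F: "finite F" "F \<subseteq> level n" for F
  proof -
    have "card F * (1/2) ^ (2 * npair j n + 2) = (\<Sum>s\<in>F. (1/2 :: real) ^ (2 * npair j n + 2))" by simp
    also have "\<dots> \<le> (\<Sum>s\<in>F. measure coin_measure (oracles n s))"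
      using F measure_oracles by (intro sum_mono) auto
    also have "\<dots> = measure coin_measure (\<Union>s\<in>F. oracles n s)"
      using F disjoint_family_on_mono[OF F(2) disjoint_oracles]
      by (intro coin.finite_measure_finite_Union[symmetric]) (auto intro: sets_oracles)
    also have "\<dots> \<le> 1" by simp
    finally have "real (card F) \<le> real (2 ^ (2 * npair j n + 2))" by (simp add: field_simps)
    then show ?thesis unfolding of_nat_le_iff .
  qed
  show "finite (level n)"
  proof (rule ccontr)
    assume "infinite (level n)"
    from infinite_arbitrarily_large[OF this, of "Suc (2 ^ (2 * npair j n + 2))"] bound
    show False by fastforce
  qed
  then show "card (level n) \<le> 2 ^ (2 * npair j n + 2)" using bound by blast
qed

definition charge :: "nat \<Rightarrow> ennreal" where
  "charge s = (if charged s then ennreal (real_of_rat (c (X s) s)) else 0)"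

lemma term_le_suminf: "f m \<le> (\<Sum>n. f n :: ennreal)"
  using sum_le_suminf[of f "{m}"] by simp

text \<open>A charge is assigned to its least level. Level 0 has finitely many stages; a charge
  first at level \<open>Suc m\<close> is at most the threshold of \<open>m\<close>; one at no level
  below \<open>s\<close> is at most the threshold of \<open>s - 1\<close>.\<close>

lemma charge_le:
  "charge s \<le> indicator (level 0) s * charge s +
    ((\<Sum>n. ennreal ((1/2) ^ threshold j n) * indicator (level (Suc n)) s) + ennreal ((1/2) ^ (s - 1)))"
  (is "_ \<le> _ + (?sum + _)")
proof (cases "charged s")
  case True
  let ?c = "real_of_rat (c (X s) s)"
  have c: "charge s = ennreal ?c" using True by (simp add: charge_def)
  show ?thesis
  proof (cases "\<exists>n<s. (1/2) ^ threshold j n < ?c")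
    case False
    moreover have "s - 1 < s" using True by (simp add: charged_def)
    ultimately have "?c \<le> (1/2) ^ threshold j (s - 1)" using not_less by blast
    also have "\<dots> \<le> (1/2) ^ (s - 1)" by (rule power_decreasing) (simp_all add: threshold_def)
    finally have "charge s \<le> ennreal ((1/2) ^ (s - 1))" unfolding c by (rule ennreal_leI)
    then show ?thesis by (simp add: add_increasing)
  next
    case ex: True
    define n where "n = (LEAST n. n < s \<and> (1/2) ^ threshold j n < ?c)"
    have n: "n < s" "(1/2) ^ threshold j n < ?c"
      using LeastI_ex[of "\<lambda>n. n < s \<and> (1/2) ^ threshold j n < ?c"] ex unfolding n_def by auto
    then have level: "s \<in> level n" using True by (simp add: level_def)
    show ?thesis
    proof (cases n)
      case 0
      then show ?thesis using level by simp
    next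
      case (Suc m)
      have "?c \<le> (1/2) ^ threshold j m"
        using not_less_Least[of m "\<lambda>n. n < s \<and> (1/2) ^ threshold j n < ?c"] n(1) Suc
        unfolding n_def[symmetric] by auto
      then have "charge s \<le> ennreal ((1/2) ^ threshold j m) * indicator (level (Suc m)) s"
        using level Suc unfolding c by (simp add: ennreal_leI)
      also have "\<dots> \<le> ?sum"
        using term_le_suminf[of "\<lambda>n. ennreal ((1/2) ^ threshold j n) * indicator (level (Suc n)) s"] by blast
      finally show ?thesis by (simp add: add_increasing add_increasing2)
    qed
  qed
qed (simp add: charge_def)

lemma suminf_half_powers: "(\<Sum>n. ennreal ((1/2) ^ n)) < \<infinity>"
  by (simp add: suminf_ennreal2 summable_geometric)

text \<open>Sums over stages are written as integrals for the counting measure in order to exchange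
  them with the sum over levels.\<close>

lemma total_cost_As: "total_cost c As < \<infinity>"
proof -
  let ?C = "count_space (UNIV :: nat set)"
  have "total_cost c As = (\<integral>\<^sup>+s. charge s \<partial>?C)"
    by (simp only: nn_integral_count_space_nat total_cost_def charge_def charged_def X_def)
  also have "\<dots> \<le> (\<integral>\<^sup>+s. indicator (level 0) s * charge s + ((\<Sum>n. ennreal ((1/2) ^ threshold j n) *
      indicator (level (Suc n)) s) + ennreal ((1/2) ^ (s - 1))) \<partial>?C)"
    by (intro nn_integral_mono charge_le)
  also have "\<dots> = (\<integral>\<^sup>+s. indicator (level 0) s * charge s \<partial>?C) +
      ((\<Sum>n. \<integral>\<^sup>+s. ennreal ((1/2) ^ threshold j n) * indicator (level (Suc n)) s \<partial>?C) +
       (\<integral>\<^sup>+s. ennreal ((1/2) ^ (s - 1)) \<partial>?C))"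
    by (simp add: nn_integral_add nn_integral_suminf)
  also have "\<dots> < \<infinity>"
  proof -
    have "(\<integral>\<^sup>+s. indicator (level 0) s * charge s \<partial>?C) = (\<Sum>s\<in>level 0. charge s)"
      by (simp add: nn_integral_count_space_nat suminf_finite[OF card_level(1)[of 0]])
    also have "\<dots> < \<infinity>" by (simp add: charge_def card_level less_top[symmetric])
    finally have 1: "(\<integral>\<^sup>+s. indicator (level 0) s * charge s \<partial>?C) < \<infinity>" .
    have "(\<integral>\<^sup>+s. ennreal ((1/2) ^ threshold j n) * indicator (level (Suc n)) s \<partial>?C) \<le> ennreal ((1/2) ^ n)" for n
    proof -
      have "(\<integral>\<^sup>+s. ennreal ((1/2) ^ threshold j n) * indicator (level (Suc n)) s \<partial>?C) =
          ennreal ((1/2) ^ threshold j n * card (level (Suc n)))"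
        using card_level(1) by (simp add: nn_integral_cmult_indicator ennreal_mult ennreal_of_nat_eq_real_of_nat)
      also have "\<dots> \<le> ennreal ((1/2) ^ n)"
      proof (rule ennreal_leI)
        have "(1/2) ^ threshold j n * real (card (level (Suc n))) \<le> (1/2) ^ threshold j n * real (2 ^ (2 * npair j (Suc n) + 2))"
          by (intro mult_left_mono of_nat_mono card_level) simp
        also have "\<dots> = (1/2) ^ n" by (simp add: threshold_def power_add field_simps)
        finally show "(1/2) ^ threshold j n * real (card (level (Suc n))) \<le> (1/2) ^ n" .
      qed
      finally show ?thesis .
    qed
    then have "(\<Sum>n. \<integral>\<^sup>+s. ennreal ((1/2) ^ threshold j n) * indicator (level (Suc n)) s \<partial>?C) \<le> (\<Sum>n. ennreal ((1/2) ^ n))"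
      by (intro suminf_le) auto
    then have 2: "(\<Sum>n. \<integral>\<^sup>+s. ennreal ((1/2) ^ threshold j n) * indicator (level (Suc n)) s \<partial>?C) < \<infinity>"
      using suminf_half_powers by (rule le_less_trans)
    have "(\<integral>\<^sup>+s. ennreal ((1/2) ^ (s - 1)) \<partial>?C) \<le> (\<Sum>s. 2 * ennreal ((1/2) ^ s))"
      unfolding nn_integral_count_space_nat
    proof (intro suminf_le)
      \<comment> \<open>At \<open>s = 0\<close> truncated subtraction makes the left side 1, which
        the factor 2 still covers.\<close>
      fix s show "ennreal ((1/2) ^ (s - 1)) \<le> 2 * ennreal ((1/2) ^ s)"
        by (cases s) (simp_all add: ennreal_leI flip: ennreal_numeral ennreal_mult)
    qed auto
    also have "\<dots> < \<infinity>"
      using suminf_half_powers by (simp add: ennreal_suminf_cmult ennreal_mult_less_top)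
    finally show ?thesis using 1 2 by (simp add: less_top)
  qed
  finally show ?thesis .
qed

lemma obeys_A: "obeys A c"
  unfolding obeys_def using computable_approximation_As total_cost_As by blast

end

theorem theorem2p6:
  fixes c :: "nat \<Rightarrow> nat \<Rightarrow> rat"
  assumes "cost_function c" and "limit_condition c"
  shows "\<exists>Y. one_random Y \<and> delta02 Y \<and> (\<forall>A. ce_set A \<and> A \<le>\<^sub>T Y \<longrightarrow> obeys A c)"
proof -
  obtain num den where "computable2 num" "computable2 den"
      "\<And>x s. den x s > 0" "\<And>x s. c x s = of_nat (num x s) / of_nat (den x s)"
    using assms(1) unfolding cost_function_def by blast
  then interpret cost c num den
    using assms(2) by unfold_locales
  obtain Y where Y: "delta02 Y"
    and avoid: "\<And>i. \<exists>\<^sub>F s in sequentially. V i s (prefix_code Y s) \<Longrightarrow> \<forall>\<^sub>F s in sequentially. certified i s"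
    using avoiding_set unfolding certified_def by blast
  have "obeys A c" if "ce_set A" "A \<le>\<^sub>T Y" for A
  proof -
    obtain p q where p: "\<And>x. eval Y p [x] (of_bool (x \<in> A))" and q: "\<And>x. x \<in> A \<longleftrightarrow> (\<exists>y. eval {} q [x] y)"
      using \<open>ce_set A\<close> \<open>A \<le>\<^sub>T Y\<close> unfolding ce_set_def turing_reducible_def by blast
    let ?j = "npair 1 (npair (code p) (code q))"
    \<comment> \<open>\<open>Y\<close> itself lies in the set of every level, as \<open>p\<close>
      computes \<open>A\<close> from \<open>Y\<close> on the finitely many costly numbers. It failed
      to avoid these sets, so they are large.\<close>
    have "\<forall>\<^sub>F s in sequentially. certified (npair ?j n) s" for n
    proof (rule avoid, rule eventually_frequently[OF sequentially_bot])
      have "\<forall>\<^sub>F s in sequentially. \<forall>x\<in>{x. \<exists>s. costly s ?j n x}.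
          steps s (prefix_code Y s) (code p) (list_encode [x]) (of_bool (x \<in> A)) \<and>
          (halted s (code q) (list_encode [x]) \<longleftrightarrow> x \<in> A)"
        unfolding q by (intro eventually_ball_finite finite_costly ballI eventually_conj
            eventually_steps p[unfolded q] eventually_halted_iff)
      then show "\<forall>\<^sub>F s in sequentially. V (npair ?j n) s (prefix_code Y s)"
      proof eventually_elim
        case (elim s)
        have "functional_stage (code p) (code q) ?j n s (prefix_code Y s)"
          unfolding functional_stage_def
        proof (intro allI impI)
          fix x assume "costly s ?j n x"
          then have "steps s (prefix_code Y s) (code p) (list_encode [x]) (of_bool (x \<in> A))"
              "halted s (code q) (list_encode [x]) \<longleftrightarrow> x \<in> A"
            using elim by blast+
          then show "steps s (prefix_code Y s) (code p) (ncons x 0) (of_bool (halted s (code q) (ncons x 0)))"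
            by simp
        qed
        then show ?case by (simp add: V_def)
      qed
    qed
    then interpret certified_reduction c num den p q A
      by unfold_locales (use q in auto)
    show ?thesis by (rule obeys_A)
  qed
  moreover have "one_random Y" by (rule one_random_if_avoiding) (rule avoid)
  ultimately show ?thesis using Y by blast
qed

end
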